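(* For any class $\mathscr{H}$ of Kripke models, the following are equivalent: (1) $\mathscr{H}$ has the Hennessy--Milner property, i.e. any $A,B\in\mathscr{H}$ satisfying the same modal formulas are bisimilar; (2) for all $A,B\in\mathscr{H}$, if the presheaf $\mathcal{M}^{A,B}\colon\boldsymbol{\omega}^{\mathrm{op}}\to\mathbf{Set}$ is strongly non-empty, then it has a global section.
   Context: Kripke models: sets with accessibility relation $R$, unary relations (one per propositional variable), distinguished element; homomorphisms preserve these. Modal formulas with standard Kripke semantics at the distinguished point. A pathwise embedding is a homomorphism reflecting unary relations; a p-morphism is a pathwise embedding $f$ with: $f(x)Ry$ implies $\exists x'$, $xRx'$, $f(x')=y$; bisimilar means joined by a span of p-morphisms. Unravelling $R_n(A,a)$: sequences $[a_0,\dots,a_j]$ of length $\le n$ with $a_0=a$, $a_\ell Ra_{\ell+1}$; $sRt$ iff $t$ extends $s$ by one; unary relations by last element; distinguished element $[a]$. A synchronization tree: Kripke model where every element is reached by a unique finite $R$-chain from the distinguished element; path: one whose tree order is a finite chain; $\mathbf{P}_n$: small skeleton of the category of paths of height $\le n$ with pathwise embeddings, with $\mathbf{P}_m\subseteq\mathbf{P}_n$ full for $m<n$. $\widehat{\mathbf{P}_n}=[\mathbf{P}_n^{\mathrm{op}},\mathbf{Set}]$ with model structure: cofibrations the monomorphisms, fibrant objects the $X$ such that for every embedding $i\colon P\to Q$ of paths in $\mathbf{P}_n$, if some arrow $Q\to X$ exists then every $P\to X$ extends along $i$; trivial fibrations are maps with right lifting property against monomorphisms. $R_nA$ is regarded in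 $\widehat{\mathbf{P}_n}$ as the presheaf $P\mapsto\{\text{pathwise embeddings }P\to R_nA\}$. For $m<n$, $\rho_{m,n}\colon\widehat{\mathbf{P}_n}\to\widehat{\mathbf{P}_m}$ is restriction along $\mathbf{P}_m\hookrightarrow\mathbf{P}_n$; canonically $\rho_{m,n}(R_nA)\cong R_mA$. For $X,Y\in\widehat{\mathbf{P}_n}$, $\mathcal{M}(X,Y)$ is the set of subobjects $W$ of $X\times Y$ such that both composites $W\to X$, $W\to Y$ with the projections are trivial fibrations (jointly monic spans of trivial fibrations up to isomorphism). $\boldsymbol{\omega}$ is the category generated by $1\to2\to3\to\cdots$. $\mathcal{M}^{A,B}(n)=\mathcal{M}(R_nA,R_nB)$, and for $m\to n$ the map $\mathcal{M}^{A,B}(n)\to\mathcal{M}^{A,B}(m)$ sends $R_nA\leftarrow Z\to R_nB$ to $R_mA\leftarrow\rho_{m,n}Z\to R_mB$. A presheaf $F$ on $\boldsymbol{\omega}$ is strongly non-empty if $F(n)\neq\emptyset$ for all $n$; a global section is a morphism from the terminal presheaf to $F$.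
   Formalization: The set of propositional variables is assumed finite; with infinitely many variables and finitary modal formulas, two modally equivalent models can be non-bisimilar while the presheaf is empty at level 2, so (2) holds and (1) fails. *)

theory Defs
  imports Main "HOL-Library.FuncSet"
begin

section \<open>Kripke models\<close>

record ('p, 'w) kripke =
  worlds :: "'w set"
  acc :: "('w \<times> 'w) set"
  val :: "'p \<Rightarrow> 'w set"
  pt :: 'w

definition kripke_model :: "('p, 'w) kripke \<Rightarrow> bool" where
  "kripke_model A \<longleftrightarrow>
     acc A \<subseteq> worlds A \<times> worlds A \<and> (\<forall>p. val A p \<subseteq> worlds A) \<and> pt A \<in> worlds A"

definition kripke_hom ::
  "('p, 'v) kripke \<Rightarrow> ('p, 'w) kripke \<Rightarrow> ('v \<Rightarrow> 'w) \<Rightarrow> bool" where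
  "kripke_hom A B f \<longleftrightarrow>
     f \<in> worlds A \<rightarrow> worlds B \<and>
     (\<forall>x y. (x, y) \<in> acc A \<longrightarrow> (f x, f y) \<in> acc B) \<and>
     (\<forall>p. \<forall>x\<in>worlds A. x \<in> val A p \<longrightarrow> f x \<in> val B p) \<and>
     f (pt A) = pt B"

definition pathwise_embedding ::
  "('p, 'v) kripke \<Rightarrow> ('p, 'w) kripke \<Rightarrow> ('v \<Rightarrow> 'w) \<Rightarrow> bool" where
  "pathwise_embedding A B f \<longleftrightarrow>
     kripke_hom A B f \<and> (\<forall>p. \<forall>x\<in>worlds A. f x \<in> val B p \<longrightarrow> x \<in> val A p)"

definition p_morphism ::
  "('p, 'v) kripke \<Rightarrow> ('p, 'w) kripke \<Rightarrow> ('v \<Rightarrow> 'w) \<Rightarrow> bool" where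
  "p_morphism A B f \<longleftrightarrow>
     pathwise_embedding A B f \<and>
     (\<forall>x\<in>worlds A. \<forall>y. (f x, y) \<in> acc B \<longrightarrow> (\<exists>x'. (x, x') \<in> acc A \<and> f x' = y))"

text \<open>
  HOL cannot quantify over the type of the apex of a span. The apex is taken in the product
  type; by \<open>bisimilarI\<close> below, a span with apex in any other type yields one of this form.
\<close>

definition bisimilar :: "('p, 'v) kripke \<Rightarrow> ('p, 'w) kripke \<Rightarrow> bool" where
  "bisimilar A B \<longleftrightarrow>
     (\<exists>(C :: ('p, 'v \<times> 'w) kripke) f g.
        kripke_model C \<and> p_morphism C A f \<and> p_morphism C B g)"

section \<open>Modal logic\<close>

datatype 'p fm =
    Atom 'p
  | Falsum
  | Neg "'p fm"
  | Conj "'p fm" "'p fm"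
  | Dia "'p fm"

fun sat :: "('p, 'w) kripke \<Rightarrow> 'w \<Rightarrow> 'p fm \<Rightarrow> bool" where
  "sat A w (Atom p) \<longleftrightarrow> w \<in> val A p"
| "sat A w Falsum \<longleftrightarrow> False"
| "sat A w (Neg \<phi>) \<longleftrightarrow> \<not> sat A w \<phi>"
| "sat A w (Conj \<phi> \<psi>) \<longleftrightarrow> sat A w \<phi> \<and> sat A w \<psi>"
| "sat A w (Dia \<phi>) \<longleftrightarrow> (\<exists>v. (w, v) \<in> acc A \<and> sat A v \<phi>)"

text \<open>
  Formulas are finitary. Agreement on all of them yields bisimilarity of the \<open>n\<close>-th unravellings,
  for every \<open>n\<close>, only when there are finitely many propositional variables; the type of
  variables is therefore of class \<open>finite\<close> where this matters.
\<close>

definition modally_equivalent :: "('p, 'v) kripke \<Rightarrow> ('p, 'w) kripke \<Rightarrow> bool" where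
  "modally_equivalent A B \<longleftrightarrow> (\<forall>\<phi>. sat A (pt A) \<phi> \<longleftrightarrow> sat B (pt B) \<phi>)"

definition hennessy_milner :: "('p, 'w) kripke set \<Rightarrow> bool" where
  "hennessy_milner H \<longleftrightarrow> (\<forall>A\<in>H. \<forall>B\<in>H. modally_equivalent A B \<longrightarrow> bisimilar A B)"

section \<open>Unravellings, synchronization trees and paths\<close>

text \<open>The length of a sequence and the height of a path both count elements.\<close>

definition unravel :: "nat \<Rightarrow> ('p, 'w) kripke \<Rightarrow> ('p, 'w list) kripke" where
  "unravel n A =
     (let S = {s. s \<noteq> [] \<and> length s \<le> n \<and> set s \<subseteq> worlds A \<and> hd s = pt A \<and>
                  successively (\<lambda>x y. (x, y) \<in> acc A) s}
      in \<lparr>worlds = S,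
          acc = {(s, t). s \<in> S \<and> t \<in> S \<and> (\<exists>x. t = s @ [x])},
          val = (\<lambda>p. {s \<in> S. last s \<in> val A p}),
          pt = [pt A]\<rparr>)"

definition chain_to :: "('p, 'w) kripke \<Rightarrow> 'w \<Rightarrow> 'w list \<Rightarrow> bool" where
  "chain_to A x s \<longleftrightarrow>
     s \<noteq> [] \<and> hd s = pt A \<and> last s = x \<and> successively (\<lambda>y z. (y, z) \<in> acc A) s"

definition synchronization_tree :: "('p, 'w) kripke \<Rightarrow> bool" where
  "synchronization_tree A \<longleftrightarrow> kripke_model A \<and> (\<forall>x\<in>worlds A. \<exists>!s. chain_to A x s)"

definition is_path :: "('p, 'w) kripke \<Rightarrow> bool" where
  "is_path P \<longleftrightarrow>
     synchronization_tree P \<and> finite (worlds P) \<and>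
     (\<forall>x\<in>worlds P. \<forall>y\<in>worlds P. (x, y) \<in> (acc P)\<^sup>* \<or> (y, x) \<in> (acc P)\<^sup>*)"

abbreviation height :: "('p, 'w) kripke \<Rightarrow> nat" where
  "height P \<equiv> card (worlds P)"

text \<open>
  The objects of the skeleton: one path on each initial segment of the natural numbers for
  each valuation. See \<open>paths_representative\<close> and \<open>paths_skeletal\<close> below.
\<close>

definition paths :: "nat \<Rightarrow> ('p, nat) kripke set" where
  "paths n =
     {P. is_path P \<and> height P \<le> n \<and>
         worlds P = {..<height P} \<and> acc P = {(j, Suc j) | j. Suc j < height P} \<and> pt P = 0}"

text \<open>
  Functions are made extensional so that equal arrows are equal as HOL functions;
  composition of arrows is the constant \<open>compose\<close>.
\<close>

definition embs :: "('p, 'v) kripke \<Rightarrow> ('p, 'w) kripke \<Rightarrow> ('v \<Rightarrow> 'w) set" where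
  "embs A B = {i \<in> extensional (worlds A). pathwise_embedding A B i}"

section \<open>Presheaves on paths\<close>

text \<open>
  \<open>sec X P\<close> is the value of the presheaf \<open>X\<close> at \<open>P\<close>, and \<open>res X P Q i\<close> is the restriction
  from \<open>Q\<close> to \<open>P\<close> along \<open>i\<close>. Values away from \<open>paths n\<close> are junk.
\<close>

record ('p, 'x) psh =
  sec :: "('p, nat) kripke \<Rightarrow> 'x set"
  res :: "('p, nat) kripke \<Rightarrow> ('p, nat) kripke \<Rightarrow> (nat \<Rightarrow> nat) \<Rightarrow> 'x \<Rightarrow> 'x"

definition presheaf :: "nat \<Rightarrow> ('p, 'x) psh \<Rightarrow> bool" where
  "presheaf n X \<longleftrightarrow>
     (\<forall>P\<in>paths n. \<forall>Q\<in>paths n. \<forall>i\<in>embs P Q. res X P Q i \<in> sec X Q \<rightarrow> sec X P) \<and>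
     (\<forall>P\<in>paths n. \<forall>x\<in>sec X P. res X P P (restrict id (worlds P)) x = x) \<and>
     (\<forall>P\<in>paths n. \<forall>Q\<in>paths n. \<forall>T\<in>paths n. \<forall>i\<in>embs P Q. \<forall>j\<in>embs Q T. \<forall>x\<in>sec X T.
        res X P T (compose (worlds P) j i) x = res X P Q i (res X Q T j x))"

definition psh_hom ::
  "nat \<Rightarrow> ('p, 'x) psh \<Rightarrow> ('p, 'y) psh \<Rightarrow> (('p, nat) kripke \<Rightarrow> 'x \<Rightarrow> 'y) \<Rightarrow> bool" where
  "psh_hom n X Y f \<longleftrightarrow>
     (\<forall>P\<in>paths n. f P \<in> sec X P \<rightarrow> sec Y P) \<and>
     (\<forall>P\<in>paths n. \<forall>Q\<in>paths n. \<forall>i\<in>embs P Q. \<forall>x\<in>sec X Q.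
        f P (res X P Q i x) = res Y P Q i (f Q x))"

definition psh_mono ::
  "nat \<Rightarrow> ('p, 'x) psh \<Rightarrow> ('p, 'y) psh \<Rightarrow> (('p, nat) kripke \<Rightarrow> 'x \<Rightarrow> 'y) \<Rightarrow> bool" where
  "psh_mono n X Y f \<longleftrightarrow> psh_hom n X Y f \<and> (\<forall>P\<in>paths n. inj_on (f P) (sec X P))"

definition lifts_against ::
  "nat \<Rightarrow> ('p, 's) psh \<Rightarrow> ('p, 't) psh \<Rightarrow> (('p, nat) kripke \<Rightarrow> 's \<Rightarrow> 't) \<Rightarrow>
   ('p, 'x) psh \<Rightarrow> ('p, 'y) psh \<Rightarrow> (('p, nat) kripke \<Rightarrow> 'x \<Rightarrow> 'y) \<Rightarrow> bool" where
  "lifts_against n S T m X Y f \<longleftrightarrow>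
     (\<forall>u v. psh_hom n S X u \<and> psh_hom n T Y v \<and>
            (\<forall>P\<in>paths n. \<forall>s\<in>sec S P. f P (u P s) = v P (m P s)) \<longrightarrow>
        (\<exists>h. psh_hom n T X h \<and>
             (\<forall>P\<in>paths n. \<forall>s\<in>sec S P. h P (m P s) = u P s) \<and>
             (\<forall>P\<in>paths n. \<forall>t\<in>sec T P. f P (h P t) = v P t)))"

text \<open>
  HOL cannot quantify over the types of the values of the test monomorphisms. They range over
  \<open>nat \<Rightarrow> nat\<close>, where representable presheaves take their values; by
  \<open>trivial_fibration_lifts\<close> below, the right lifting property then holds against the
  monomorphisms between presheaves with values in arbitrary types.
\<close>

definition trivial_fibration ::
  "nat \<Rightarrow> ('p, 'x) psh \<Rightarrow> ('p, 'y) psh \<Rightarrow> (('p, nat) kripke \<Rightarrow> 'x \<Rightarrow> 'y) \<Rightarrow> bool" where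
  "trivial_fibration n X Y f \<longleftrightarrow>
     psh_hom n X Y f \<and>
     (\<forall>(S :: ('p, nat \<Rightarrow> nat) psh) (T :: ('p, nat \<Rightarrow> nat) psh) m.
        presheaf n S \<and> presheaf n T \<and> psh_mono n S T m \<longrightarrow> lifts_against n S T m X Y f)"

definition emb_psh :: "('p, 'w) kripke \<Rightarrow> ('p, nat \<Rightarrow> 'w) psh" where
  "emb_psh A = \<lparr>sec = (\<lambda>P. embs P A), res = (\<lambda>P Q i x. compose (worlds P) x i)\<rparr>"

definition prod_psh :: "('p, 'x) psh \<Rightarrow> ('p, 'y) psh \<Rightarrow> ('p, 'x \<times> 'y) psh" where
  "prod_psh X Y =
     \<lparr>sec = (\<lambda>P. sec X P \<times> sec Y P), res = (\<lambda>P Q i. map_prod (res X P Q i) (res Y P Q i))\<rparr>"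

text \<open>
  A subobject is represented by its unique representative that is a subpresheaf with inclusion
  as the monomorphism. Emptiness away from \<open>paths n\<close> removes the junk values.
\<close>

definition subobject ::
  "nat \<Rightarrow> ('p, 'x) psh \<Rightarrow> (('p, nat) kripke \<Rightarrow> 'x set) \<Rightarrow> bool" where
  "subobject n X W \<longleftrightarrow>
     (\<forall>P\<in>paths n. W P \<subseteq> sec X P) \<and> (\<forall>P. P \<notin> paths n \<longrightarrow> W P = {}) \<and>
     (\<forall>P\<in>paths n. \<forall>Q\<in>paths n. \<forall>i\<in>embs P Q. res X P Q i \<in> W Q \<rightarrow> W P)"

definition subpsh ::
  "('p, 'x) psh \<Rightarrow> (('p, nat) kripke \<Rightarrow> 'x set) \<Rightarrow> ('p, 'x) psh" where
  "subpsh X W = X\<lparr>sec := W\<rparr>"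

definition spans ::
  "nat \<Rightarrow> ('p, 'x) psh \<Rightarrow> ('p, 'y) psh \<Rightarrow> (('p, nat) kripke \<Rightarrow> ('x \<times> 'y) set) set" where
  "spans n X Y =
     {W. subobject n (prod_psh X Y) W \<and>
         trivial_fibration n (subpsh (prod_psh X Y) W) X (\<lambda>P. fst) \<and>
         trivial_fibration n (subpsh (prod_psh X Y) W) Y (\<lambda>P. snd)}"

text \<open>
  Restriction to shorter paths, on families of sets and on presheaves. The canonical
  isomorphism from the restriction of \<open>R\<^sub>n A\<close> to \<open>R\<^sub>m A\<close> is an identity here, see
  \<open>rho_unravel\<close>, so a subobject is sent to its plain restriction.
\<close>

definition restrict_paths ::
  "nat \<Rightarrow> (('p, nat) kripke \<Rightarrow> 'x set) \<Rightarrow> ('p, nat) kripke \<Rightarrow> 'x set" where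
  "restrict_paths m W = (\<lambda>P. if P \<in> paths m then W P else {})"

definition rho :: "nat \<Rightarrow> ('p, 'x) psh \<Rightarrow> ('p, 'x) psh" where
  "rho m X = X\<lparr>sec := restrict_paths m (sec X)\<rparr>"

section \<open>Presheaves on omega\<close>

text \<open>
  The objects are the positive natural numbers. For \<open>1 \<le> m \<le> n\<close>, the unique arrow from \<open>m\<close>
  to \<open>n\<close> acts as \<open>om_map F m n\<close>, from \<open>om_ob F n\<close> to \<open>om_ob F m\<close>.
\<close>

record 'a omega_psh =
  om_ob :: "nat \<Rightarrow> 'a set"
  om_map :: "nat \<Rightarrow> nat \<Rightarrow> 'a \<Rightarrow> 'a"

definition omega_presheaf :: "'a omega_psh \<Rightarrow> bool" where
  "omega_presheaf F \<longleftrightarrow>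
     (\<forall>m n. 1 \<le> m \<and> m \<le> n \<longrightarrow> om_map F m n \<in> om_ob F n \<rightarrow> om_ob F m) \<and>
     (\<forall>n\<ge>1. \<forall>x\<in>om_ob F n. om_map F n n x = x) \<and>
     (\<forall>l m n. 1 \<le> l \<and> l \<le> m \<and> m \<le> n \<longrightarrow>
        (\<forall>x\<in>om_ob F n. om_map F l n x = om_map F l m (om_map F m n x)))"

definition omega_hom :: "'a omega_psh \<Rightarrow> 'b omega_psh \<Rightarrow> (nat \<Rightarrow> 'a \<Rightarrow> 'b) \<Rightarrow> bool" where
  "omega_hom F G t \<longleftrightarrow>
     (\<forall>n\<ge>1. t n \<in> om_ob F n \<rightarrow> om_ob G n) \<and>
     (\<forall>m n. 1 \<le> m \<and> m \<le> n \<longrightarrow>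
        (\<forall>x\<in>om_ob F n. t m (om_map F m n x) = om_map G m n (t n x)))"

definition omega_terminal :: "unit omega_psh" where
  "omega_terminal = \<lparr>om_ob = (\<lambda>n. {()}), om_map = (\<lambda>m n x. x)\<rparr>"

definition strongly_nonempty :: "'a omega_psh \<Rightarrow> bool" where
  "strongly_nonempty F \<longleftrightarrow> (\<forall>n\<ge>1. om_ob F n \<noteq> {})"

definition has_global_section :: "'a omega_psh \<Rightarrow> bool" where
  "has_global_section F \<longleftrightarrow> (\<exists>t. omega_hom omega_terminal F t)"

text \<open>That this is a presheaf is \<open>omega_presheaf_M_psh\<close> below.\<close>

definition M_psh ::
  "('p, 'v) kripke \<Rightarrow> ('p, 'w) kripke \<Rightarrow>
   (('p, nat) kripke \<Rightarrow> ((nat \<Rightarrow> 'v list) \<times> (nat \<Rightarrow> 'w list)) set) omega_psh" where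
  "M_psh A B =
     \<lparr>om_ob = (\<lambda>n. spans n (emb_psh (unravel n A)) (emb_psh (unravel n B))),
      om_map = (\<lambda>m n. restrict_paths m)\<rparr>"

section \<open>Adequacy of the encodings\<close>

lemma bisimilarI:
  fixes C :: "('p, 'c) kripke" and A :: "('p, 'v) kripke" and B :: "('p, 'w) kripke"
  assumes C: "kripke_model C" and f: "p_morphism C A f" and g: "p_morphism C B g"
  shows "bisimilar A B"
proof -
  define D :: "('p, 'v \<times> 'w) kripke" where
    "D = \<lparr>worlds = (\<lambda>c. (f c, g c)) ` worlds C,
          acc = (\<lambda>(c, c'). ((f c, g c), (f c', g c'))) ` acc C,
          val = (\<lambda>p. (\<lambda>c. (f c, g c)) ` val C p),
          pt = (f (pt C), g (pt C))\<rparr>"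
  have accC: "c \<in> worlds C \<and> c' \<in> worlds C" if "(c, c') \<in> acc C" for c c'
    using that C by (auto simp: kripke_model_def)
  have valC: "c \<in> worlds C" if "c \<in> val C p" for c p
    using that C by (auto simp: kripke_model_def)
  have D: "kripke_model D"
    unfolding kripke_model_def
  proof (intro conjI allI)
    show "acc D \<subseteq> worlds D \<times> worlds D"
      using accC by (auto simp: D_def)
    show "val D p \<subseteq> worlds D" for p
      unfolding D_def using valC by (auto intro!: imageI)
    show "pt D \<in> worlds D"
      using C by (auto simp: D_def kripke_model_def)
  qed
  have "p_morphism D A fst"
    unfolding p_morphism_def pathwise_embedding_def kripke_hom_def
  proof (intro conjI ballI allI impI)
    show "fst \<in> worlds D \<rightarrow> worlds A"
      using f by (auto simp: D_def p_morphism_def pathwise_embedding_def kripke_hom_def)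
    show "(fst x, fst y) \<in> acc A" if "(x, y) \<in> acc D" for x y
      using f that by (auto simp: D_def p_morphism_def pathwise_embedding_def kripke_hom_def)
    show "fst x \<in> val A p" if x: "x \<in> val D p" for x p
    proof -
      obtain c where c: "c \<in> val C p" "x = (f c, g c)" using x by (auto simp: D_def)
      with valC[OF c(1)] f show ?thesis
        by (simp add: p_morphism_def pathwise_embedding_def kripke_hom_def)
    qed
    show "fst (pt D) = pt A"
      using f by (auto simp: D_def p_morphism_def pathwise_embedding_def kripke_hom_def)
    show "x \<in> val D p" if "x \<in> worlds D" "fst x \<in> val A p" for x p
      using f that by (auto simp: D_def p_morphism_def pathwise_embedding_def kripke_hom_def)
    show "\<exists>x'. (x, x') \<in> acc D \<and> fst x' = y"
      if x: "x \<in> worlds D" and y: "(fst x, y) \<in> acc A" for x y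
    proof -
      obtain c where c: "c \<in> worlds C" "x = (f c, g c)" using x by (auto simp: D_def)
      then obtain c' where "(c, c') \<in> acc C" "f c' = y"
        using f y by (auto simp: p_morphism_def)
      with c show ?thesis
        by (intro exI[of _ "(f c', g c')"]) (force simp: D_def)
    qed
  qed
  moreover have "p_morphism D B snd"
    unfolding p_morphism_def pathwise_embedding_def kripke_hom_def
  proof (intro conjI ballI allI impI)
    show "snd \<in> worlds D \<rightarrow> worlds B"
      using g by (auto simp: D_def p_morphism_def pathwise_embedding_def kripke_hom_def)
    show "(snd x, snd y) \<in> acc B" if "(x, y) \<in> acc D" for x y
      using g that by (auto simp: D_def p_morphism_def pathwise_embedding_def kripke_hom_def)
    show "snd x \<in> val B p" if x: "x \<in> val D p" for x p
    proof -
      obtain c where c: "c \<in> val C p" "x = (f c, g c)" using x by (auto simp: D_def)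
      with valC[OF c(1)] g show ?thesis
        by (simp add: p_morphism_def pathwise_embedding_def kripke_hom_def)
    qed
    show "snd (pt D) = pt B"
      using g by (auto simp: D_def p_morphism_def pathwise_embedding_def kripke_hom_def)
    show "x \<in> val D p" if "x \<in> worlds D" "snd x \<in> val B p" for x p
      using g that by (auto simp: D_def p_morphism_def pathwise_embedding_def kripke_hom_def)
    show "\<exists>x'. (x, x') \<in> acc D \<and> snd x' = y"
      if x: "x \<in> worlds D" and y: "(snd x, y) \<in> acc B" for x y
    proof -
      obtain c where c: "c \<in> worlds C" "x = (f c, g c)" using x by (auto simp: D_def)
      then obtain c' where "(c, c') \<in> acc C" "g c' = y"
        using g y by (auto simp: p_morphism_def)
      with c show ?thesis
        by (intro exI[of _ "(f c', g c')"]) (force simp: D_def)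
    qed
  qed
  ultimately show ?thesis using D unfolding bisimilar_def by blast
qed

lemma paths_worlds: "P \<in> paths n \<Longrightarrow> worlds P = {..<height P}"
  and paths_acc: "P \<in> paths n \<Longrightarrow> acc P = {(j, Suc j) | j. Suc j < height P}"
  and paths_pt: "P \<in> paths n \<Longrightarrow> pt P = 0"
  and paths_height: "P \<in> paths n \<Longrightarrow> height P \<le> n"
  and paths_model: "P \<in> paths n \<Longrightarrow> kripke_model P"
  by (simp_all add: paths_def is_path_def synchronization_tree_def)

lemma paths_in_worlds: "P \<in> paths n \<Longrightarrow> x \<in> worlds P \<longleftrightarrow> x < height P"
  using paths_worlds[of P n] by (metis lessThan_iff)

lemma paths_iff_height: "P \<in> paths n \<Longrightarrow> P \<in> paths m \<longleftrightarrow> height P \<le> m"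
  unfolding paths_def by blast

lemma paths_height_pos: "P \<in> paths n \<Longrightarrow> 0 < height P"
  using paths_model[of P n] paths_in_worlds[of P n] by (auto simp: kripke_model_def)

lemma paths_mono: "m \<le> n \<Longrightarrow> paths m \<subseteq> paths n"
  by (auto simp: paths_def)

lemma succ_chain:
  assumes "s \<noteq> []" "hd s = 0" "successively (\<lambda>y z. z = Suc y) s"
  shows "s = [0..<length s]"
  using assms
proof (induction s rule: rev_induct)
  case (snoc x s)
  show ?case
  proof (cases "s = []")
    case False
    with snoc have s: "s = [0..<length s]" and x: "x = Suc (last s)"
      by (auto simp: successively_append_iff)
    have "last s = length s - 1"
      using False by (subst s) (simp add: last_upt)
    with x False have "x = length s" by simp
    with s show ?thesis by simp
  qed (use snoc in auto)
qed simp

lemma successor_path: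
  fixes P :: "('p, nat) kripke"
  assumes "kripke_model P" and W: "worlds P = {..<k}"
    and R: "acc P = {(j, Suc j) | j. Suc j < k}" and pt: "pt P = 0"
  shows "is_path P"
proof -
  have ch: "chain_to P x s \<longleftrightarrow> s = [0..<Suc x]" if x: "x < k" for x s
  proof
    assume c: "chain_to P x s"
    have "successively (\<lambda>y z. z = Suc y) s"
      using c by (auto simp: chain_to_def R elim: successively_mono)
    with c have s: "s = [0..<length s]"
      by (intro succ_chain) (auto simp: chain_to_def pt)
    have "x = last s" "s \<noteq> []" using c by (auto simp: chain_to_def)
    moreover have "last s = length s - 1"
      using \<open>s \<noteq> []\<close> by (subst s) (simp add: last_upt)
    ultimately have "length s = Suc x" by simp
    with s show "s = [0..<Suc x]" by simp
  next
    have "successively (\<lambda>y z. (y, z) \<in> acc P) [0..<m]" if "m \<le> k" for m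
      using that
    proof (induction m)
      case (Suc m)
      then show ?case
        by (cases "m = 0") (auto simp: successively_append_iff R last_upt)
    qed simp
    then show "s = [0..<Suc x] \<Longrightarrow> chain_to P x s"
      using x by (auto simp: chain_to_def pt hd_upt simp del: upt_Suc)
  qed
  have star: "(a, a + d) \<in> (acc P)\<^sup>*" if "a + d < k" for a d
    using that
  proof (induction d)
    case (Suc d)
    then have "(a, a + d) \<in> (acc P)\<^sup>*" "(a + d, Suc (a + d)) \<in> acc P" by (auto simp: R)
    then show ?case by (simp add: rtrancl_into_rtrancl)
  qed simp
  have "(x, y) \<in> (acc P)\<^sup>* \<or> (y, x) \<in> (acc P)\<^sup>*" if "x < k" "y < k" for x y
    using star[of x "y - x"] star[of y "x - y"] that by (cases "x \<le> y") auto
  with assms ch show ?thesis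
    by (auto simp: is_path_def synchronization_tree_def)
qed

lemma paths_representative:
  fixes P :: "('p, 'w) kripke"
  assumes P: "is_path P" and n: "height P \<le> n"
  obtains Q i j where "Q \<in> paths n" "i \<in> embs P Q" "j \<in> embs Q P"
    "compose (worlds P) j i = restrict id (worlds P)"
    "compose (worlds Q) i j = restrict id (worlds Q)"
proof -
  define k where "k = height P"
  have mod: "kripke_model P" and fin: "finite (worlds P)"
    and uniq: "\<And>x. x \<in> worlds P \<Longrightarrow> \<exists>!s. chain_to P x s"
    and lin: "\<And>x y. x \<in> worlds P \<Longrightarrow> y \<in> worlds P \<Longrightarrow>
       (x, y) \<in> (acc P)\<^sup>* \<or> (y, x) \<in> (acc P)\<^sup>*"
    using P by (auto simp: is_path_def synchronization_tree_def)
  have accW: "x \<in> worlds P \<and> y \<in> worlds P" if "(x, y) \<in> acc P" for x y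
    using mod that by (auto simp: kripke_model_def)
  have ptW: "pt P \<in> worlds P" using mod by (simp add: kripke_model_def)
  define c where "c x = (THE s. chain_to P x s)" for x
  have c: "chain_to P x (c x)" if "x \<in> worlds P" for x
    unfolding c_def by (rule theI') (rule uniq[OF that])
  have cI: "c x = s" if "x \<in> worlds P" "chain_to P x s" for x s
    using uniq[OF that(1)] c[OF that(1)] that(2) by blast
  define d where "d x = length (c x) - 1" for x
  have d0: "d (pt P) = 0"
    using cI[OF ptW, of "[pt P]"] by (simp add: d_def chain_to_def)
  have dSuc: "d y = Suc (d x)" if a: "(x, y) \<in> acc P" for x y
  proof -
    have cx: "chain_to P x (c x)" using accW[OF a] c by blast
    then have "chain_to P y (c x @ [y])"
      using a by (auto simp: chain_to_def successively_append_iff)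
    then have "c y = c x @ [y]" using accW[OF a] cI by blast
    moreover have "c x \<noteq> []" using cx by (simp add: chain_to_def)
    ultimately show ?thesis by (cases "c x") (simp_all add: d_def)
  qed
  have pred: "\<exists>x. (x, y) \<in> acc P \<and> d x = e" if y: "y \<in> worlds P" and e: "d y = Suc e" for y e
  proof -
    have cy: "chain_to P y (c y)" using c y by blast
    then obtain s where s: "c y = s @ [y]"
      by (metis append_butlast_last_id chain_to_def)
    with e have "s \<noteq> []" by (auto simp: d_def)
    with cy s have a: "(last s, y) \<in> acc P"
      by (auto simp: chain_to_def successively_append_iff)
    with dSuc[OF a] e show ?thesis by auto
  qed
  have mono: "x = y \<or> d x < d y" if "(x, y) \<in> (acc P)\<^sup>*" for x y
    using that
  proof (induction rule: rtrancl_induct)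
    case (step y z)
    then show ?case using dSuc[OF step(2)] by auto
  qed simp
  have inj: "inj_on d (worlds P)"
    by (rule inj_onI) (metis lin mono less_irrefl)
  have down: "e \<in> d ` worlds P" if "f \<in> d ` worlds P" "e \<le> f" for e f
    using that(2,1)
  proof (induction rule: inc_induct)
    case (step m)
    then obtain y where "y \<in> worlds P" "d y = Suc m" by auto
    with pred accW show ?case by blast
  qed
  have img: "d ` worlds P = {..<k}"
  proof -
    let ?D = "d ` worlds P"
    have cD: "card ?D = k" using inj by (simp add: card_image k_def)
    have "e < k" if "e \<in> ?D" for e
    proof -
      have "{..e} \<subseteq> ?D" using down that by auto
      then have "card {..e} \<le> k" using card_mono[of ?D "{..e}"] fin cD by simp
      then show ?thesis by simp
    qed
    then have "?D \<subseteq> {..<k}" by auto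
    with cD show ?thesis by (simp add: card_subset_eq)
  qed
  have accI: "(x, y) \<in> acc P" if "x \<in> worlds P" "y \<in> worlds P" "d y = Suc (d x)" for x y
  proof -
    obtain x' where "(x', y) \<in> acc P" "d x' = d x" using pred[OF \<open>y \<in> worlds P\<close> \<open>d y = Suc (d x)\<close>] by blast
    moreover from this have "x' = x" using inj accW that by (metis inj_onD)
    ultimately show ?thesis by simp
  qed
  define Q :: "('p, nat) kripke" where
    "Q = \<lparr>worlds = {..<k}, acc = {(j, Suc j) | j. Suc j < k}, val = (\<lambda>p. d ` val P p), pt = 0\<rparr>"
  have valW: "val P p \<subseteq> worlds P" for p using mod by (simp add: kripke_model_def)
  have kpos: "0 < k" using ptW fin by (auto simp: k_def card_gt_0_iff)
  have "kripke_model Q"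
    unfolding kripke_model_def Q_def using kpos valW img by auto
  then have "is_path Q" by (rule successor_path) (auto simp: Q_def)
  then have QP: "Q \<in> paths n" using n by (auto simp: paths_def Q_def k_def)
  define i where "i = restrict d (worlds P)"
  define j where "j = restrict (inv_into (worlds P) d) {..<k}"
  have jW: "j a \<in> worlds P" and dj: "d (j a) = a" if "a < k" for a
    using that img by (auto simp: j_def inv_into_into f_inv_into_f)
  have jd: "j (d x) = x" and dk: "d x < k" if "x \<in> worlds P" for x
    using that img inj by (auto simp: j_def)
  have "i \<in> embs P Q"
  proof -
    have "d x \<in> d ` val P p \<longleftrightarrow> x \<in> val P p" if "x \<in> worlds P" for x p
      using inj that valW by (simp add: inj_on_image_mem_iff)
    moreover have "Suc (d x) < k \<and> d y = Suc (d x)" if "(x, y) \<in> acc P" for x y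
      using dSuc[OF that] dk accW[OF that] by metis
    ultimately show ?thesis
      using dk ptW d0 accW
      by (auto simp: embs_def pathwise_embedding_def kripke_hom_def i_def Q_def)
  qed
  moreover have "j \<in> embs Q P"
  proof -
    have "(j a, j (Suc a)) \<in> acc P" if "Suc a < k" for a
      using that by (intro accI jW) (auto simp: dj)
    moreover have "j 0 = pt P" using jd[OF ptW] d0 by simp
    moreover have "j a \<in> val P p \<longleftrightarrow> a \<in> d ` val P p" if "a < k" for a p
      using dj[OF that] jd valW by force
    moreover have "j \<in> extensional {..<k}" by (simp add: j_def)
    ultimately show ?thesis
      using jW by (auto simp: embs_def pathwise_embedding_def kripke_hom_def Q_def)
  qed
  moreover have "compose (worlds P) j i = restrict id (worlds P)"
    by (rule ext) (auto simp: compose_def i_def jd)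
  moreover have "compose (worlds Q) i j = restrict id (worlds Q)"
    by (rule ext) (auto simp: compose_def i_def Q_def jW dj)
  ultimately show ?thesis using QP that by blast
qed

lemma embs_paths:
  assumes P: "P \<in> paths n" and Q: "Q \<in> paths n'" and i: "i \<in> embs P Q"
  shows "i = restrict id (worlds P)" "height P \<le> height Q"
    "val P p = val Q p \<inter> {..<height P}"
proof -
  note [simp] = paths_pt[OF P] paths_pt[OF Q] paths_acc[OF P] paths_acc[OF Q]
  note W = paths_in_worlds[OF P] paths_in_worlds[OF Q]
  have hom: "kripke_hom P Q i" using i by (simp add: embs_def pathwise_embedding_def)
  have id: "i a = a" if "a < height P" for a
    using that
  proof (induction a)
    case 0
    then show ?case using hom by (simp add: kripke_hom_def)
  next
    case (Suc a)
    then have "(a, Suc a) \<in> acc P" by simp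
    then have "(i a, i (Suc a)) \<in> acc Q" using hom unfolding kripke_hom_def by blast
    then have "i (Suc a) = Suc (i a)" by simp
    with Suc show ?case by simp
  qed
  show "i = restrict id (worlds P)"
  proof
    fix a show "i a = restrict id (worlds P) a"
      using i id W(1) by (cases "a \<in> worlds P") (auto simp: embs_def extensional_def)
  qed
  have map: "i \<in> worlds P \<rightarrow> worlds Q" using hom by (simp add: kripke_hom_def)
  have last: "height P - 1 < height P" using paths_height_pos[OF P] by simp
  then have "i (height P - 1) \<in> worlds Q" using map W(1) by blast
  then have "height P - 1 < height Q" using W(2) id[OF last] by simp
  then show "height P \<le> height Q" by simp
  have "val P p \<subseteq> {..<height P}"
    using paths_model[OF P] paths_worlds[OF P] unfolding kripke_model_def by blast
  moreover have "a \<in> val P p \<longleftrightarrow> a \<in> val Q p" if a: "a < height P" for a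
  proof -
    have "a \<in> worlds P" using W(1) a by blast
    then have "a \<in> val P p \<longleftrightarrow> i a \<in> val Q p"
      using i unfolding embs_def pathwise_embedding_def kripke_hom_def by blast
    then show ?thesis using id[OF a] by simp
  qed
  ultimately show "val P p = val Q p \<inter> {..<height P}" by auto
qed

lemma paths_eqI:
  assumes P: "P \<in> paths n" and Q: "Q \<in> paths n'" and h: "height P = height Q"
    and v: "\<And>p. val P p = val Q p"
  shows "P = Q"
proof (intro kripke.equality ext)
  show "worlds P = worlds Q" using paths_in_worlds[OF P] paths_in_worlds[OF Q] h by auto
  show "acc P = acc Q" using paths_acc[OF P] paths_acc[OF Q] h by simp
  show "pt P = pt Q" using paths_pt[OF P] paths_pt[OF Q] by simp
qed (use v in auto)

lemma paths_skeletal: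
  assumes P: "P \<in> paths n" and Q: "Q \<in> paths n" and "i \<in> embs P Q" "j \<in> embs Q P"
  shows "P = Q"
proof (rule paths_eqI[OF P Q])
  show h: "height P = height Q"
    by (intro order_antisym embs_paths(2)[OF P Q assms(3)] embs_paths(2)[OF Q P assms(4)])
  have "val Q p \<subseteq> {..<height Q}" for p
    using paths_model[OF Q] paths_worlds[OF Q] unfolding kripke_model_def by blast
  then show "val P p = val Q p" for p
    using embs_paths(3)[OF P Q assms(3), of p] h by auto
qed

lemma embs_compose:
  assumes "i \<in> embs A B" "j \<in> embs B C"
    and "kripke_model A"
  shows "compose (worlds A) j i \<in> embs A C"
proof -
  let ?k = "compose (worlds A) j i"
  have k: "?k x = j (i x)" if "x \<in> worlds A" for x using that by (simp add: compose_eq)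
  have i: "pathwise_embedding A B i" and j: "pathwise_embedding B C j"
    using assms by (auto simp: embs_def)
  have acc: "x \<in> worlds A \<and> y \<in> worlds A" if "(x, y) \<in> acc A" for x y
    using assms(3) that by (auto simp: kripke_model_def)
  have pt: "pt A \<in> worlds A" using assms(3) by (simp add: kripke_model_def)
  have iW: "i x \<in> worlds B" if "x \<in> worlds A" for x
    using i that by (auto simp: pathwise_embedding_def kripke_hom_def)
  have "?k \<in> worlds A \<rightarrow> worlds C"
    using k iW j by (auto simp: pathwise_embedding_def kripke_hom_def)
  moreover have "(?k x, ?k y) \<in> acc C" if "(x, y) \<in> acc A" for x y
  proof -
    have "(j (i x), j (i y)) \<in> acc C"
      using i j that unfolding pathwise_embedding_def kripke_hom_def by blast
    then show ?thesis using k acc[OF that] by simp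
  qed
  moreover have "?k x \<in> val C p \<longleftrightarrow> x \<in> val A p" if "x \<in> worlds A" for x p
    using i j k[OF that] that iW[OF that] unfolding pathwise_embedding_def kripke_hom_def by metis
  moreover have "?k (pt A) = pt C"
    using i j k[OF pt] by (simp add: pathwise_embedding_def kripke_hom_def)
  ultimately show ?thesis
    by (simp add: embs_def pathwise_embedding_def kripke_hom_def)
qed

lemma embs_id: "kripke_model A \<Longrightarrow> restrict id (worlds A) \<in> embs A A"
  unfolding embs_def pathwise_embedding_def kripke_hom_def kripke_model_def by auto

lemma presheaf_emb_psh: "presheaf n (emb_psh A)"
proof -
  have "compose (worlds P) x (restrict id (worlds P)) = x" if "x \<in> embs P A"
    for P :: "('a, nat) kripke" and x
    using that by (intro ext) (auto simp: embs_def compose_def extensional_def)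
  moreover have "compose (worlds P) x (compose (worlds P) j i) =
      compose (worlds P) (compose (worlds Q) x j) i" if "i \<in> embs P Q"
    for P Q :: "('a, nat) kripke" and x :: "nat \<Rightarrow> 'b" and i j
    using that by (intro ext)
      (auto simp: embs_def pathwise_embedding_def kripke_hom_def compose_def)
  moreover have "compose (worlds P) x i \<in> embs P A" if "P \<in> paths n" "i \<in> embs P Q" "x \<in> embs Q A"
    for P Q :: "('a, nat) kripke" and x :: "nat \<Rightarrow> 'b" and i
    using embs_compose[OF that(2,3) paths_model[OF that(1)]] .
  ultimately show ?thesis
    unfolding presheaf_def emb_psh_def by (auto simp: Pi_iff)
qed

lemma presheafD:
  assumes "presheaf n X"
  shows "P \<in> paths n \<Longrightarrow> Q \<in> paths n \<Longrightarrow> i \<in> embs P Q \<Longrightarrow> x \<in> sec X Q \<Longrightarrow> res X P Q i x \<in> sec X P"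
    "P \<in> paths n \<Longrightarrow> x \<in> sec X P \<Longrightarrow> res X P P (restrict id (worlds P)) x = x"
    "P \<in> paths n \<Longrightarrow> Q \<in> paths n \<Longrightarrow> T \<in> paths n \<Longrightarrow> i \<in> embs P Q \<Longrightarrow> j \<in> embs Q T \<Longrightarrow>
       x \<in> sec X T \<Longrightarrow> res X P T (compose (worlds P) j i) x = res X P Q i (res X Q T j x)"
  using assms unfolding presheaf_def by blast+

lemma presheafI:
  assumes "\<And>P Q i x. P \<in> paths n \<Longrightarrow> Q \<in> paths n \<Longrightarrow> i \<in> embs P Q \<Longrightarrow> x \<in> sec X Q \<Longrightarrow>
      res X P Q i x \<in> sec X P"
    and "\<And>P x. P \<in> paths n \<Longrightarrow> x \<in> sec X P \<Longrightarrow> res X P P (restrict id (worlds P)) x = x"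
    and "\<And>P Q T i j x. P \<in> paths n \<Longrightarrow> Q \<in> paths n \<Longrightarrow> T \<in> paths n \<Longrightarrow> i \<in> embs P Q \<Longrightarrow>
      j \<in> embs Q T \<Longrightarrow> x \<in> sec X T \<Longrightarrow>
      res X P T (compose (worlds P) j i) x = res X P Q i (res X Q T j x)"
  shows "presheaf n X"
  unfolding presheaf_def using assms by (intro conjI ballI Pi_I)

lemma presheaf_subpsh:
  assumes X: "presheaf n X" and W: "subobject n X W"
  shows "presheaf n (subpsh X W)"
proof (rule presheafI)
  fix P Q :: "('a, nat) kripke" and i x
  assume PQ: "P \<in> paths n" "Q \<in> paths n" "i \<in> embs P Q" and x: "x \<in> sec (subpsh X W) Q"
  from x have x: "x \<in> W Q" by (simp add: subpsh_def)
  have "res X P Q i x \<in> W P" using W PQ x unfolding subobject_def by blast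
  then show "res (subpsh X W) P Q i x \<in> sec (subpsh X W) P" by (simp add: subpsh_def)
next
  fix P :: "('a, nat) kripke" and x
  assume P: "P \<in> paths n" and x: "x \<in> sec (subpsh X W) P"
  from x have "x \<in> W P" by (simp add: subpsh_def)
  with W P have "x \<in> sec X P" unfolding subobject_def by blast
  from presheafD(2)[OF X P this]
  show "res (subpsh X W) P P (restrict id (worlds P)) x = x" by (simp add: subpsh_def)
next
  fix P Q T :: "('a, nat) kripke" and i j x
  assume PQT: "P \<in> paths n" "Q \<in> paths n" "T \<in> paths n" "i \<in> embs P Q" "j \<in> embs Q T"
    and x: "x \<in> sec (subpsh X W) T"
  from x have "x \<in> W T" by (simp add: subpsh_def)
  with W PQT have "x \<in> sec X T" unfolding subobject_def by blast
  from presheafD(3)[OF X PQT this]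
  show "res (subpsh X W) P T (compose (worlds P) j i) x =
      res (subpsh X W) P Q i (res (subpsh X W) Q T j x)" by (simp add: subpsh_def)
qed

lemma presheaf_prod_psh:
  assumes "presheaf n X" "presheaf n Y"
  shows "presheaf n (prod_psh X Y)"
  by (rule presheafI)
    (auto simp: prod_psh_def presheafD[OF assms(1)] presheafD[OF assms(2)])

lemma rho_unravel:
  fixes A :: "('p, 'w) kripke"
  assumes "m \<le> n"
  shows "rho m (emb_psh (unravel n A)) = rho m (emb_psh (unravel m A))"
proof -
  let ?C = "\<lambda>n. unravel n A"
  have "embs P (?C n) = embs P (?C m)" if P: "P \<in> paths m" for P :: "('p, nat) kripke"
  proof
    note W = paths_in_worlds[OF P] and R = paths_acc[OF P] and pt = paths_pt[OF P]
      and h = paths_height[OF P]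
    have 1: "x \<in> worlds (?C n) \<longleftrightarrow> x \<in> worlds (?C m)"
      "x \<in> val (?C n) p \<longleftrightarrow> x \<in> val (?C m) p"
      "(y, x) \<in> acc (?C n) \<longleftrightarrow> (y, x) \<in> acc (?C m)" if "length x \<le> m" for x y p
      proof -
      have "length x \<le> n" using that assms by simp
      with that show "x \<in> worlds (?C n) \<longleftrightarrow> x \<in> worlds (?C m)"
        "x \<in> val (?C n) p \<longleftrightarrow> x \<in> val (?C m) p"
        by (simp_all add: unravel_def Let_def)
      have "length y \<le> m \<and> length y \<le> n" if "x = y @ [w]" for w
        using that \<open>length x \<le> n\<close> \<open>length x \<le> m\<close> by simp
      with that \<open>length x \<le> n\<close> show "(y, x) \<in> acc (?C n) \<longleftrightarrow> (y, x) \<in> acc (?C m)"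
        unfolding unravel_def Let_def by (simp, blast)
    qed
    have len: "length (i a) = Suc a"
      if "kripke_hom P (?C l) i" "a < height P" for i a l
      using that(2)
    proof (induction a)
      case 0
      then show ?case using that(1) pt by (simp add: kripke_hom_def unravel_def Let_def)
    next
      case (Suc a)
      then have "(a, Suc a) \<in> acc P" by (simp add: R)
      then have "(i a, i (Suc a)) \<in> acc (?C l)"
        using that(1) unfolding kripke_hom_def by blast
      then have "length (i (Suc a)) = Suc (length (i a))"
        by (auto simp: unravel_def Let_def)
      with Suc show ?case by simp
    qed
    have le: "length (i a) \<le> m" if "kripke_hom P (?C l) i" "a \<in> worlds P" for i a l
    proof -
      have "a < height P" using that(2) W by simp
      with len[OF that(1) this] h show ?thesis by simp
    qed
    have accW: "y \<in> worlds P" if "(x, y) \<in> acc P" for x y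
      using that unfolding R W by blast
    have ptC: "pt (?C n) = pt (?C m)" by (simp add: unravel_def Let_def)
    have conv: "pathwise_embedding P (?C n) i \<longleftrightarrow> pathwise_embedding P (?C m) i"
      if le: "\<And>a. a \<in> worlds P \<Longrightarrow> length (i a) \<le> m" for i
    proof -
      have "i \<in> worlds P \<rightarrow> worlds (?C n) \<longleftrightarrow> i \<in> worlds P \<rightarrow> worlds (?C m)"
        using 1(1)[OF le] by (auto simp: Pi_iff)
      moreover have "(\<forall>x y. (x, y) \<in> acc P \<longrightarrow> (i x, i y) \<in> acc (?C n)) \<longleftrightarrow>
          (\<forall>x y. (x, y) \<in> acc P \<longrightarrow> (i x, i y) \<in> acc (?C m))"
        using 1(3)[OF le[OF accW]] by blast
      moreover have "i x \<in> val (?C n) p \<longleftrightarrow> i x \<in> val (?C m) p" if "x \<in> worlds P" for x p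
        by (rule 1(2)[OF le[OF that]])
      ultimately show ?thesis
        unfolding pathwise_embedding_def kripke_hom_def ptC by blast
    qed
    show "embs P (?C n) \<subseteq> embs P (?C m)" "embs P (?C m) \<subseteq> embs P (?C n)"
      using conv le unfolding embs_def pathwise_embedding_def by blast+
  qed
  then have "restrict_paths m (\<lambda>P. embs P (?C n)) = restrict_paths m (\<lambda>P. embs P (?C m))"
    unfolding restrict_paths_def by (intro ext) auto
  then show ?thesis
    by (simp add: rho_def emb_psh_def)
qed

lemma psh_mono_iff_left_cancellable:
  fixes X :: "('p, 'x) psh" and Y :: "('p, 'y) psh"
  assumes X: "presheaf n X" and f: "psh_hom n X Y f"
  shows "psh_mono n X Y f \<longleftrightarrow>
    (\<forall>(Z :: ('p, 'x \<times> 'x) psh) g h.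
       presheaf n Z \<and> psh_hom n Z X g \<and> psh_hom n Z X h \<and>
       (\<forall>P\<in>paths n. \<forall>z\<in>sec Z P. f P (g P z) = f P (h P z)) \<longrightarrow>
       (\<forall>P\<in>paths n. \<forall>z\<in>sec Z P. g P z = h P z))" (is "_ \<longleftrightarrow> ?R")
proof
  assume "psh_mono n X Y f"
  then show ?R
    unfolding psh_mono_def psh_hom_def inj_on_def by (metis PiE)
next
  assume R: ?R
  define K where "K P = {z \<in> sec (prod_psh X X) P. P \<in> paths n \<and> f P (fst z) = f P (snd z)}" for P
  have "subobject n (prod_psh X X) K"
    using X f unfolding subobject_def K_def presheaf_def psh_hom_def
    by (auto simp: prod_psh_def Pi_iff)
  then have "presheaf n (subpsh (prod_psh X X) K)"
    using X by (intro presheaf_subpsh presheaf_prod_psh)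
  moreover have "psh_hom n (subpsh (prod_psh X X) K) X (\<lambda>P. fst)"
    "psh_hom n (subpsh (prod_psh X X) K) X (\<lambda>P. snd)"
    by (auto simp: psh_hom_def subpsh_def K_def prod_psh_def)
  ultimately have *: "\<forall>P\<in>paths n. \<forall>z\<in>K P. fst z = snd z"
    using R[rule_format, of "subpsh (prod_psh X X) K" "\<lambda>P. fst" "\<lambda>P. snd"]
    by (simp add: subpsh_def K_def)
  have "inj_on (f P) (sec X P)" if "P \<in> paths n" for P
  proof (rule inj_onI)
    fix x y assume "x \<in> sec X P" "y \<in> sec X P" "f P x = f P y"
    then have "(x, y) \<in> K P" using that by (simp add: K_def prod_psh_def)
    with * that show "x = y" by fastforce
  qed
  with f show "psh_mono n X Y f" by (simp add: psh_mono_def)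
qed

definition trunc :: "nat \<Rightarrow> ('p, nat) kripke \<Rightarrow> ('p, nat) kripke" where
  "trunc k P = \<lparr>worlds = {..<k}, acc = {(j, Suc j) | j. Suc j < k},
     val = (\<lambda>p. val P p \<inter> {..<k}), pt = 0\<rparr>"

lemma height_trunc: "height (trunc k P) = k"
  by (simp add: trunc_def)

lemma trunc_paths: "0 < k \<Longrightarrow> trunc k P \<in> paths k"
proof -
  assume k: "0 < k"
  then have "kripke_model (trunc k P)" by (auto simp: trunc_def kripke_model_def)
  then have "is_path (trunc k P)"
    by (rule successor_path) (simp_all add: trunc_def)
  then show ?thesis by (simp add: paths_def height_trunc) (simp add: trunc_def)
qed

lemma embs_eq_trunc:
  assumes P: "P \<in> paths n" and Q: "Q \<in> paths n'" and i: "i \<in> embs P Q"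
  shows "P = trunc (height P) Q"
proof (rule paths_eqI[OF P trunc_paths[OF paths_height_pos[OF P]]])
  show "height P = height (trunc (height P) Q)" by (simp add: height_trunc)
  show "val P p = val (trunc (height P) Q) p" for p
    using embs_paths(3)[OF P Q i] by (simp add: trunc_def)
qed

lemma trunc_embs:
  assumes P: "P \<in> paths n" and k: "0 < k" "k \<le> height P"
  shows "restrict id {..<k} \<in> embs (trunc k P) P"
  using k paths_in_worlds[OF P] paths_acc[OF P] paths_pt[OF P]
  unfolding embs_def pathwise_embedding_def kripke_hom_def trunc_def by auto

lemma trunc_trunc: "j \<le> k \<Longrightarrow> trunc j (trunc k P) = trunc j P"
  by (auto simp: trunc_def)

lemma res_sec:
  "presheaf n X \<Longrightarrow> P \<in> paths n \<Longrightarrow> Q \<in> paths n \<Longrightarrow> i \<in> embs P Q \<Longrightarrow> x \<in> sec X Q \<Longrightarrow>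
   res X P Q i x \<in> sec X P"
  by (auto simp: presheaf_def)

lemma res_self:
  assumes "presheaf n X" "P \<in> paths n" "i \<in> embs P P" "x \<in> sec X P"
  shows "res X P P i x = x"
  using assms embs_paths(1)[OF assms(2,2,3)] by (simp add: presheaf_def)

lemma res_res:
  assumes X: "presheaf n X" and P: "P \<in> paths n" and Q: "Q \<in> paths n" and T: "T \<in> paths n"
    and i: "i \<in> embs P Q" and j: "j \<in> embs Q T" and k: "k \<in> embs P T" and x: "x \<in> sec X T"
  shows "res X P Q i (res X Q T j x) = res X P T k x"
proof -
  have "compose (worlds P) j i \<in> embs P T"
    by (rule embs_compose[OF i j paths_model[OF P]])
  then have "compose (worlds P) j i = k"
    using embs_paths(1)[OF P T] k by metis
  with assms show ?thesis unfolding presheaf_def by metis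
qed

lemma psh_hom_sec: "psh_hom n X Y f \<Longrightarrow> P \<in> paths n \<Longrightarrow> x \<in> sec X P \<Longrightarrow> f P x \<in> sec Y P"
  by (auto simp: psh_hom_def)

lemma psh_hom_res:
  "psh_hom n X Y f \<Longrightarrow> P \<in> paths n \<Longrightarrow> Q \<in> paths n \<Longrightarrow> i \<in> embs P Q \<Longrightarrow> x \<in> sec X Q \<Longrightarrow>
   f P (res X P Q i x) = res Y P Q i (f Q x)"
  by (auto simp: psh_hom_def)

lemma trunc_paths_n:
  "P \<in> paths n \<Longrightarrow> 0 < k \<Longrightarrow> k \<le> height P \<Longrightarrow> trunc k P \<in> paths n"
  using trunc_paths[of k P] paths_mono[of k n] paths_height[of P n] by auto

lemma embs_height_less:
  assumes P: "P \<in> paths n" and Q: "Q \<in> paths n" and i: "i \<in> embs Q P" and "Q \<noteq> P"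
  shows "height Q < height P"
proof (rule ccontr)
  assume "\<not> height Q < height P"
  then have h: "height Q = height P" using embs_paths(2)[OF Q P i] by simp
  have "P = trunc (height P) P" by (rule embs_eq_trunc[OF P P embs_id[OF paths_model[OF P]]])
  moreover have "Q = trunc (height P) P" using embs_eq_trunc[OF Q P i] h by simp
  ultimately show False using \<open>Q \<noteq> P\<close> by simp
qed

lemma embs_trunc:
  assumes P: "P \<in> paths n" and Q: "Q \<in> paths n" and i: "i \<in> embs Q P"
    and k: "height Q \<le> k" "k \<le> height P"
  shows "i \<in> embs Q (trunc k P)"
proof -
  have kp: "0 < k" using paths_height_pos[OF Q] k by simp
  have "Q = trunc (height Q) (trunc k P)"
    using embs_eq_trunc[OF Q P i] k by (simp add: trunc_trunc)
  moreover have "restrict id {..<height Q} \<in> embs (trunc (height Q) (trunc k P)) (trunc k P)"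
    using k paths_height_pos[OF Q]
    by (intro trunc_embs[OF trunc_paths[OF kp]]) (auto simp: height_trunc)
  ultimately show ?thesis using embs_paths(1)[OF Q P i] paths_worlds[OF Q] by metis
qed

lemma trivial_fibration_extend:
  fixes P :: "('p, nat) kripke"
  defines "k \<equiv> height P - 1"
  assumes X: "presheaf n X" and Y: "presheaf n Y" and tf: "trivial_fibration n X Y f"
    and P: "P \<in> paths n" and y: "y \<in> sec Y P"
    and x: "0 < k \<Longrightarrow> x \<in> sec X (trunc k P)"
      "0 < k \<Longrightarrow> f (trunc k P) x = res Y (trunc k P) P (restrict id {..<k}) y"
  obtains z where "z \<in> sec X P" "f P z = y"
    "0 < k \<Longrightarrow> res X (trunc k P) P (restrict id {..<k}) z = x"
proof -
  let ?P' = "trunc k P"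
  let ?T = "emb_psh P"
  define W where "W Q = (if Q \<in> paths n \<and> Q \<noteq> P then embs Q P else {})" for Q
  let ?S = "subpsh ?T W"
  define u where "u Q i = res X Q ?P' i x" for Q i
  define v where "v Q i = res Y Q P i y" for Q i
  have f: "psh_hom n X Y f" using tf by (simp add: trivial_fibration_def)
  have T: "presheaf n ?T" by (rule presheaf_emb_psh)
  have less: "height Q < height P" if "Q \<in> paths n" "i \<in> W Q" for Q i
    using that embs_height_less[OF P] by (auto simp: W_def split: if_splits)
  have Wemb: "i \<in> embs Q P" if "i \<in> W Q" for Q i
    using that by (auto simp: W_def split: if_splits)
  have emb: "i \<in> embs Q ?P'" and kpos: "0 < k" if "Q \<in> paths n" "i \<in> W Q" for Q i
  proof -
    have "height Q \<le> k" using less[OF that] by (simp add: k_def)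
    then show "i \<in> embs Q ?P'"
      using embs_trunc[OF P that(1) Wemb[OF that(2)]] by (simp add: k_def)
    show "0 < k" using \<open>height Q \<le> k\<close> paths_height_pos[OF that(1)] by simp
  qed
  have P': "?P' \<in> paths n" if "0 < k"
    using trunc_paths_n[OF P that] by (simp add: k_def)
  have comp: "compose (worlds Q) j i \<in> W Q"
    if "Q \<in> paths n" "R \<in> paths n" "i \<in> embs Q R" "j \<in> W R" for Q R i j
  proof -
    have "height Q < height P" using embs_paths(2)[OF that(1-3)] less[OF that(2,4)] by simp
    then show ?thesis
      using embs_compose[OF that(3) Wemb[OF that(4)] paths_model[OF that(1)]] that(1)
      by (auto simp: W_def)
  qed
  have sub: "subobject n ?T W"
    unfolding subobject_def using comp by (auto simp: emb_psh_def W_def split: if_splits)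
  have S: "presheaf n ?S" by (rule presheaf_subpsh[OF T sub])
  have Ssec: "sec ?S Q = W Q" for Q by (simp add: subpsh_def)
  have Sres: "res ?S Q R i j = compose (worlds Q) j i" for Q R i j
    by (simp add: subpsh_def emb_psh_def)
  have m: "psh_mono n ?S ?T (\<lambda>Q. id)"
    unfolding psh_mono_def psh_hom_def
  proof (intro conjI ballI)
    fix Q :: "('p, nat) kripke" assume Q: "Q \<in> paths n"
    show "id \<in> sec ?S Q \<rightarrow> sec ?T Q"
      unfolding Ssec using Wemb by (simp add: emb_psh_def)
    show "inj_on id (sec ?S Q)" by simp
  qed (simp add: subpsh_def)
  have u: "psh_hom n ?S X u"
    unfolding psh_hom_def Ssec Sres
  proof (intro conjI ballI)
    fix Q :: "('p, nat) kripke" assume Q: "Q \<in> paths n"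
    show "u Q \<in> W Q \<rightarrow> sec X Q"
      unfolding u_def using res_sec[OF X Q P'] emb[OF Q] kpos[OF Q] x(1) by blast
    fix R i j assume R: "R \<in> paths n" and i: "i \<in> embs Q R" and j: "j \<in> W R"
    note kp = kpos[OF R j]
    show "u Q (compose (worlds Q) j i) = res X Q R i (u R j)"
      unfolding u_def
      by (rule res_res[OF X Q R P'[OF kp] i emb[OF R j] emb[OF Q comp[OF Q R i j]] x(1)[OF kp], symmetric])
  qed
  have v: "psh_hom n ?T Y v"
    unfolding psh_hom_def v_def
  proof (intro conjI ballI)
    fix Q :: "('p, nat) kripke" assume Q: "Q \<in> paths n"
    show "(\<lambda>i. res Y Q P i y) \<in> sec ?T Q \<rightarrow> sec Y Q"
      using res_sec[OF Y Q P _ y] by (auto simp: emb_psh_def)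
    fix R i j assume R: "R \<in> paths n" and i: "i \<in> embs Q R" and j: "j \<in> sec ?T R"
    then have j': "j \<in> embs R P" by (simp add: emb_psh_def)
    show "res Y Q P (res ?T Q R i j) y = res Y Q R i (res Y R P j y)"
      using res_res[OF Y Q R P i j' embs_compose[OF i j' paths_model[OF Q]] y]
      by (simp add: emb_psh_def)
  qed
  have sq: "f Q (u Q i) = v Q (id i)" if Q: "Q \<in> paths n" and i: "i \<in> sec ?S Q" for Q i
  proof -
    from i have i: "i \<in> W Q" by (simp add: Ssec)
    note kp = kpos[OF Q i] and e = emb[OF Q i]
    have inc: "restrict id {..<k} \<in> embs ?P' P"
      using trunc_embs[OF P kp] by (simp add: k_def)
    have "f Q (u Q i) = res Y Q ?P' i (f ?P' x)"
      unfolding u_def by (rule psh_hom_res[OF f Q P'[OF kp] e x(1)[OF kp]])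
    also have "\<dots> = res Y Q P i y"
      unfolding x(2)[OF kp] by (rule res_res[OF Y Q P'[OF kp] P e inc Wemb[OF i] y])
    finally show ?thesis by (simp add: v_def)
  qed
  have "lifts_against n ?S ?T (\<lambda>Q. id) X Y f"
    using tf S T m unfolding trivial_fibration_def by blast
  then have "\<exists>h. psh_hom n ?T X h \<and>
      (\<forall>P\<in>paths n. \<forall>s\<in>sec ?S P. h P (id s) = u P s) \<and>
      (\<forall>P\<in>paths n. \<forall>t\<in>sec ?T P. f P (h P t) = v P t)"
    unfolding lifts_against_def
    by (elim allE[of _ u] allE[of _ v]) (use u v sq in blast)
  then obtain h where h: "psh_hom n ?T X h"
    and hu: "\<And>Q i. Q \<in> paths n \<Longrightarrow> i \<in> W Q \<Longrightarrow> h Q i = u Q i"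
    and hv: "\<And>Q i. Q \<in> paths n \<Longrightarrow> i \<in> sec ?T Q \<Longrightarrow> f Q (h Q i) = v Q i"
    unfolding Ssec id_apply by blast
  define e where "e = restrict id (worlds P)"
  have e: "e \<in> embs P P" "e \<in> sec ?T P"
    using embs_id[OF paths_model[OF P]] by (auto simp: e_def emb_psh_def)
  show ?thesis
  proof (rule that[of "h P e"])
    show "h P e \<in> sec X P" by (rule psh_hom_sec[OF h P e(2)])
    show "f P (h P e) = y"
      using hv[OF P e(2)] res_self[OF Y P e(1) y] by (simp add: v_def)
    assume kp: "0 < k"
    let ?i = "restrict id {..<k}"
    have inc: "?i \<in> embs ?P' P" using trunc_embs[OF P kp] by (simp add: k_def)
    let ?c = "compose (worlds ?P') e ?i"
    have c: "?c \<in> embs ?P' P" by (rule embs_compose[OF inc e(1) paths_model[OF P'[OF kp]]])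
    moreover have "?P' \<noteq> P"
      using height_trunc[of k P] paths_height_pos[OF P] by (auto simp: k_def)
    ultimately have cW: "?c \<in> W ?P'" using P'[OF kp] by (simp add: W_def)
    have "res X ?P' P ?i (h P e) = h ?P' (res ?T ?P' P ?i e)"
      by (rule psh_hom_res[OF h P'[OF kp] P inc e(2), symmetric])
    also have "\<dots> = u ?P' ?c" using hu[OF P'[OF kp] cW] by (simp add: emb_psh_def)
    also have "\<dots> = x"
      unfolding u_def by (rule res_self[OF X P'[OF kp] emb[OF P'[OF kp] cW] x(1)[OF kp]])
    finally show "res X ?P' P ?i (h P e) = x" .
  qed
qed

lemma psh_hom_le: "k \<le> n \<Longrightarrow> psh_hom n X Y f \<Longrightarrow> psh_hom k X Y f"
  unfolding psh_hom_def using paths_mono[of k n] by blast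

theorem trivial_fibration_lifts:
  fixes S :: "('p, 's) psh" and T :: "('p, 't) psh" and X :: "('p, 'x) psh" and Y :: "('p, 'y) psh"
  assumes X: "presheaf n X" and Y: "presheaf n Y" and S: "presheaf n S" and T: "presheaf n T"
    and tf: "trivial_fibration n X Y f" and m: "psh_mono n S T m"
  shows "lifts_against n S T m X Y f"
  unfolding lifts_against_def
proof (intro allI impI, elim conjE)
  fix u v
  assume u: "psh_hom n S X u" and v: "psh_hom n T Y v"
    and "\<forall>P\<in>paths n. \<forall>s\<in>sec S P. f P (u P s) = v P (m P s)"
  then have sq: "\<And>P s. P \<in> paths n \<Longrightarrow> s \<in> sec S P \<Longrightarrow> f P (u P s) = v P (m P s)" by blast
  have f: "psh_hom n X Y f" using tf by (simp add: trivial_fibration_def)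
  have mh: "psh_hom n S T m" and mi: "\<And>P. P \<in> paths n \<Longrightarrow> inj_on (m P) (sec S P)"
    using m by (auto simp: psh_mono_def)
  let ?lift = "\<lambda>k h. psh_hom k T X h \<and> (\<forall>P\<in>paths k. \<forall>s\<in>sec S P. h P (m P s) = u P s) \<and>
      (\<forall>P\<in>paths k. \<forall>t\<in>sec T P. f P (h P t) = v P t)"
  have "\<exists>h. ?lift k h" if "k \<le> n" for k
    using that
  proof (induction k)
    case 0
    have "paths 0 = ({} :: ('p, nat) kripke set)" using paths_height_pos paths_height by fastforce
    then show ?case by (simp add: psh_hom_def)
  next
    case (Suc k)
    then obtain h where h: "psh_hom k T X h"
      and hm: "\<And>P s. P \<in> paths k \<Longrightarrow> s \<in> sec S P \<Longrightarrow> h P (m P s) = u P s"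
      and hv: "\<And>P t. P \<in> paths k \<Longrightarrow> t \<in> sec T P \<Longrightarrow> f P (h P t) = v P t"
      by auto
    have kn: "P \<in> paths n" if "P \<in> paths k \<or> P \<in> paths (Suc k)" for P :: "('p, nat) kripke"
      using that paths_mono[of k n] paths_mono[of "Suc k" n] Suc.prems by auto
    let ?i = "restrict id {..<k}"
    let ?good = "\<lambda>P t z. z \<in> sec X P \<and> f P z = v P t \<and> (\<forall>s\<in>sec S P. t = m P s \<longrightarrow> z = u P s) \<and>
       (0 < k \<longrightarrow> res X (trunc k P) P ?i z = h (trunc k P) (res T (trunc k P) P ?i t))"
    have ex: "\<exists>z. ?good P t z"
      if P: "P \<in> paths n" and hP: "height P = Suc k" and t: "t \<in> sec T P" for P t
    proof -
      let ?P' = "trunc k P"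
      have P'k: "?P' \<in> paths k" if "0 < k" by (rule trunc_paths[OF that])
      have inc: "?i \<in> embs ?P' P" if "0 < k" using trunc_embs[OF P that] hP by simp
      have r: "res T ?P' P ?i t \<in> sec T ?P'" if "0 < k"
        using res_sec[OF T kn P inc[OF that] t] P'k[OF that] by simp
      show ?thesis
      proof (cases "\<exists>s\<in>sec S P. t = m P s")
        case True
        then obtain s where s: "s \<in> sec S P" "t = m P s" by blast
        have "res X ?P' P ?i (u P s) = h ?P' (res T ?P' P ?i t)" if "0 < k"
        proof -
          have P': "?P' \<in> paths n" using kn P'k[OF that] by blast
          have rs: "res S ?P' P ?i s \<in> sec S ?P'" by (rule res_sec[OF S P' P inc[OF that] s(1)])
          have "h ?P' (res T ?P' P ?i t) = h ?P' (m ?P' (res S ?P' P ?i s))"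
            unfolding s(2) by (simp add: psh_hom_res[OF mh P' P inc[OF that] s(1)])
          also have "\<dots> = u ?P' (res S ?P' P ?i s)" by (rule hm[OF P'k[OF that] rs])
          also have "\<dots> = res X ?P' P ?i (u P s)" by (rule psh_hom_res[OF u P' P inc[OF that] s(1)])
          finally show ?thesis by simp
        qed
        moreover have "\<forall>s'\<in>sec S P. t = m P s' \<longrightarrow> u P s = u P s'"
        proof (intro ballI impI)
          fix s' assume "s' \<in> sec S P" "t = m P s'"
          with s have "s = s'" by (intro inj_onD[OF mi[OF P]]) simp_all
          then show "u P s = u P s'" by simp
        qed
        moreover have "f P (u P s) = v P t" unfolding s(2) by (rule sq[OF P s(1)])
        ultimately show ?thesis using psh_hom_sec[OF u P s(1)] by blast
      next
        case False
        have y: "v P t \<in> sec Y P" by (rule psh_hom_sec[OF v P t])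
        have k: "height P - 1 = k" using hP by simp
        let ?x = "h ?P' (res T ?P' P ?i t)"
        have x1: "?x \<in> sec X ?P'" if "0 < k"
          by (rule psh_hom_sec[OF h P'k[OF that] r[OF that]])
        have x2: "f ?P' ?x = res Y ?P' P ?i (v P t)" if "0 < k"
        proof -
          have "?P' \<in> paths n" using kn P'k[OF that] by blast
          then have "v ?P' (res T ?P' P ?i t) = res Y ?P' P ?i (v P t)"
            by (rule psh_hom_res[OF v _ P inc[OF that] t])
          with hv[OF P'k[OF that] r[OF that]] show ?thesis by simp
        qed
        show ?thesis
        proof (rule trivial_fibration_extend[OF X Y tf P y, unfolded k, OF x1 x2])
          fix z
          assume "z \<in> sec X P" "f P z = v P t" "0 < k \<Longrightarrow> res X ?P' P ?i z = ?x"
          then have "?good P t z" using False by blast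
          then show ?thesis by (rule exI)
        qed
      qed
    qed
    define h' where "h' P t = (if P \<in> paths k then h P t else SOME z. ?good P t z)" for P t
    have new: "height P = Suc k" if "P \<in> paths (Suc k)" "P \<notin> paths k" for P :: "('p, nat) kripke"
      using that paths_iff_height[OF that(1), of k] paths_height[OF that(1)] by simp
    have good: "?good P t (h' P t)"
      if P: "P \<in> paths (Suc k)" "P \<notin> paths k" and t: "t \<in> sec T P" for P t
    proof -
      have "?good P t (SOME z. ?good P t z)"
        by (rule someI_ex, rule ex[OF _ new[OF P] t]) (use kn P(1) in blast)
      then show ?thesis using P by (simp add: h'_def)
    qed
    have hsec: "h' P t \<in> sec X P" if "P \<in> paths (Suc k)" "t \<in> sec T P" for P t
      using good[OF that(1) _ that(2)] psh_hom_sec[OF h _ that(2)]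
      by (cases "P \<in> paths k") (auto simp: h'_def)
    have "psh_hom (Suc k) T X h'"
      unfolding psh_hom_def
    proof (intro conjI ballI)
      fix P :: "('p, nat) kripke" assume P: "P \<in> paths (Suc k)"
      show "h' P \<in> sec T P \<rightarrow> sec X P" using hsec[OF P] by blast
      fix Q i t assume Q: "Q \<in> paths (Suc k)" and i: "i \<in> embs P Q" and t: "t \<in> sec T Q"
      have Pn: "P \<in> paths n" and Qn: "Q \<in> paths n" using P Q kn by blast+
      show "h' P (res T P Q i t) = res X P Q i (h' Q t)"
      proof (cases "P = Q")
        case True
        then show ?thesis
          using res_self[OF T Qn _ t] res_self[OF X Qn _ hsec[OF Q t]] i by simp
      next
        case False
        have less: "height P < height Q" by (rule embs_height_less[OF Qn Pn i False])
        then have Pk: "P \<in> paths k"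
          using paths_iff_height[OF P, of k] paths_height[OF Q] by simp
        show ?thesis
        proof (cases "Q \<in> paths k")
          case True
          then show ?thesis using Pk psh_hom_res[OF h Pk True i t] by (simp add: h'_def)
        next
          case False
          note hQ = new[OF Q False]
          have kp: "0 < k" using less hQ paths_height_pos[OF Pn] by simp
          let ?Q' = "trunc k Q"
          have Q'k: "?Q' \<in> paths k" by (rule trunc_paths[OF kp])
          then have Q'n: "?Q' \<in> paths n" using kn by blast
          have inc: "?i \<in> embs ?Q' Q" using trunc_embs[OF Qn kp] hQ by simp
          have i': "i \<in> embs P ?Q'" using embs_trunc[OF Qn Pn i, of k] less hQ by simp
          have "res X P Q i (h' Q t) = res X P ?Q' i (res X ?Q' Q ?i (h' Q t))"
            by (rule res_res[OF X Pn Q'n Qn i' inc i hsec[OF Q t], symmetric])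
          also have "\<dots> = res X P ?Q' i (h ?Q' (res T ?Q' Q ?i t))"
            using good[OF Q False t] kp by simp
          also have "\<dots> = h P (res T P ?Q' i (res T ?Q' Q ?i t))"
            by (rule psh_hom_res[OF h Pk Q'k i' res_sec[OF T Q'n Qn inc t], symmetric])
          also have "\<dots> = h P (res T P Q i t)"
            by (simp add: res_res[OF T Pn Q'n Qn i' inc i t])
          finally show ?thesis using Pk by (simp add: h'_def)
        qed
      qed
    qed
    moreover have "h' P (m P s) = u P s" if "P \<in> paths (Suc k)" "s \<in> sec S P" for P s
      using good[OF that(1) _ psh_hom_sec[OF mh kn that(2)]] hm that
      by (cases "P \<in> paths k") (auto simp: h'_def)
    moreover have "f P (h' P t) = v P t" if "P \<in> paths (Suc k)" "t \<in> sec T P" for P t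
      using good[OF that(1) _ that(2)] hv that by (cases "P \<in> paths k") (auto simp: h'_def)
    ultimately show ?case by blast
  qed
  from this[OF order_refl] show "\<exists>h. ?lift n h" .
qed

lemma subobject_restrict_paths:
  assumes "m \<le> n" "subobject n X W"
  shows "subobject m X (restrict_paths m W)"
proof -
  have "P \<in> paths n" if "P \<in> paths m" for P :: "('a, nat) kripke"
    using that paths_mono[OF assms(1)] by blast
  with assms(2) show ?thesis unfolding subobject_def restrict_paths_def by simp
qed

lemma embs_paths_le:
  assumes "P \<in> paths n" "Q \<in> paths n" "i \<in> embs P Q" "Q \<in> paths m"
  shows "P \<in> paths m"
  using embs_paths(2)[OF assms(1-3)] paths_height[OF assms(4)] paths_iff_height[OF assms(1)]
  by simp

lemma sec_rho: "sec (rho m X) P = (if P \<in> paths m then sec X P else {})"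
  and res_rho: "res (rho m X) = res X"
  by (simp_all add: rho_def restrict_paths_def)

lemma psh_hom_rho:
  assumes "m \<le> n"
  shows "psh_hom n (rho m X) Y f \<longleftrightarrow> psh_hom m X Y f"
proof
  have sub: "P \<in> paths n" if "P \<in> paths m" for P :: "('a, nat) kripke"
    using that paths_mono[OF assms] by blast
  assume f: "psh_hom n (rho m X) Y f"
  show "psh_hom m X Y f"
    unfolding psh_hom_def
  proof (intro conjI ballI Pi_I)
    fix P :: "('a, nat) kripke" assume P: "P \<in> paths m"
    show "f P x \<in> sec Y P" if "x \<in> sec X P" for x
      using psh_hom_sec[OF f sub[OF P], of x] P that by (simp add: sec_rho)
    fix Q i x assume "Q \<in> paths m" "i \<in> embs P Q" "x \<in> sec X Q"
    then show "f P (res X P Q i x) = res Y P Q i (f Q x)"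
      using psh_hom_res[OF f sub[OF P] sub, of Q i x] by (simp add: sec_rho res_rho)
  qed
next
  assume f: "psh_hom m X Y f"
  show "psh_hom n (rho m X) Y f"
    unfolding psh_hom_def
  proof (intro conjI ballI Pi_I)
    fix P :: "('a, nat) kripke" assume P: "P \<in> paths n"
    show "f P x \<in> sec Y P" if "x \<in> sec (rho m X) P" for x
      using psh_hom_sec[OF f, of P x] that by (simp add: sec_rho split: if_splits)
    fix Q i x assume Q: "Q \<in> paths n" and i: "i \<in> embs P Q" and x: "x \<in> sec (rho m X) Q"
    then have Qm: "Q \<in> paths m" and x: "x \<in> sec X Q" by (simp_all add: sec_rho split: if_splits)
    show "f P (res (rho m X) P Q i x) = res Y P Q i (f Q x)"
      unfolding res_rho by (rule psh_hom_res[OF f embs_paths_le[OF P Q i Qm] Qm i x])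
  qed
qed

lemma psh_hom_into_rho: "psh_hom m X (rho m Y) f \<longleftrightarrow> psh_hom m X Y f"
  by (simp add: psh_hom_def sec_rho res_rho)

lemma presheaf_rho:
  assumes X: "presheaf m X"
  shows "presheaf n (rho m X)"
proof (rule presheafI)
  fix P Q :: "('a, nat) kripke" and i x
  assume P: "P \<in> paths n" and Q: "Q \<in> paths n" and i: "i \<in> embs P Q" and "x \<in> sec (rho m X) Q"
  then have Qm: "Q \<in> paths m" and x: "x \<in> sec X Q" by (simp_all add: sec_rho split: if_splits)
  have Pm: "P \<in> paths m" by (rule embs_paths_le[OF P Q i Qm])
  show "res (rho m X) P Q i x \<in> sec (rho m X) P"
    using Pm presheafD(1)[OF X Pm Qm i x] by (simp add: sec_rho res_rho)
next
  fix P :: "('a, nat) kripke" and x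
  assume "x \<in> sec (rho m X) P"
  then have Pm: "P \<in> paths m" and x: "x \<in> sec X P" by (simp_all add: sec_rho split: if_splits)
  show "res (rho m X) P P (restrict id (worlds P)) x = x"
    unfolding res_rho by (rule presheafD(2)[OF X Pm x])
next
  fix P Q T :: "('a, nat) kripke" and i j x
  assume P: "P \<in> paths n" and Q: "Q \<in> paths n" and T: "T \<in> paths n"
    and i: "i \<in> embs P Q" and j: "j \<in> embs Q T" and "x \<in> sec (rho m X) T"
  then have Tm: "T \<in> paths m" and x: "x \<in> sec X T" by (simp_all add: sec_rho split: if_splits)
  have Qm: "Q \<in> paths m" by (rule embs_paths_le[OF Q T j Tm])
  have Pm: "P \<in> paths m" by (rule embs_paths_le[OF P Q i Qm])
  show "res (rho m X) P T (compose (worlds P) j i) x =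
      res (rho m X) P Q i (res (rho m X) Q T j x)"
    unfolding res_rho by (rule presheafD(3)[OF X Pm Qm Tm i j x])
qed

lemma trivial_fibration_rho:
  assumes mn: "m \<le> n" and tf: "trivial_fibration n X Y f"
  shows "trivial_fibration m (rho m X) (rho m Y) f"
proof -
  have f: "psh_hom n X Y f" using tf by (simp add: trivial_fibration_def)
  have f': "psh_hom m (rho m X) (rho m Y) f"
    using psh_hom_le[OF mn f] psh_hom_rho[of m m X Y f] by (simp add: psh_hom_into_rho)
  have "lifts_against m S T k (rho m X) (rho m Y) f"
    if S: "presheaf m S" and T: "presheaf m T" and k: "psh_mono m S T k"
    for S T :: "('a, nat \<Rightarrow> nat) psh" and k
    unfolding lifts_against_def psh_hom_into_rho
  proof (intro allI impI, elim conjE)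
    fix u v
    assume u: "psh_hom m S X u" and v: "psh_hom m T Y v"
      and sq: "\<forall>P\<in>paths m. \<forall>s\<in>sec S P. f P (u P s) = v P (k P s)"
    have "psh_hom m S (rho m T) k" using k by (simp add: psh_mono_def psh_hom_into_rho)
    then have "psh_hom n (rho m S) (rho m T) k" by (simp add: psh_hom_rho[OF mn])
    then have "psh_mono n (rho m S) (rho m T) k"
      using k by (simp add: psh_mono_def sec_rho)
    then have l: "lifts_against n (rho m S) (rho m T) k X Y f"
      using tf presheaf_rho[OF S, of n] presheaf_rho[OF T, of n]
      unfolding trivial_fibration_def by blast
    have u': "psh_hom n (rho m S) X u" and v': "psh_hom n (rho m T) Y v"
      using u v by (simp_all add: psh_hom_rho[OF mn])
    have sq': "\<forall>P\<in>paths n. \<forall>s\<in>sec (rho m S) P. f P (u P s) = v P (k P s)"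
      using sq by (simp add: sec_rho)
    obtain h where h: "psh_hom n (rho m T) X h"
      and hu: "\<forall>P\<in>paths n. \<forall>s\<in>sec (rho m S) P. h P (k P s) = u P s"
      and hv: "\<forall>P\<in>paths n. \<forall>t\<in>sec (rho m T) P. f P (h P t) = v P t"
      using l u' v' sq' unfolding lifts_against_def by blast
    have "psh_hom m T X h" using h by (simp add: psh_hom_rho[OF mn])
    moreover have "h P (k P s) = u P s" if P: "P \<in> paths m" and s: "s \<in> sec S P" for P s
    proof -
      have "P \<in> paths n" using P paths_mono[OF mn] by blast
      moreover have "s \<in> sec (rho m S) P" using P s by (simp add: sec_rho)
      ultimately show ?thesis using hu by blast
    qed
    moreover have "f P (h P t) = v P t" if P: "P \<in> paths m" and t: "t \<in> sec T P" for P t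
    proof -
      have "P \<in> paths n" using P paths_mono[OF mn] by blast
      moreover have "t \<in> sec (rho m T) P" using P t by (simp add: sec_rho)
      ultimately show ?thesis using hv by blast
    qed
    ultimately show "\<exists>h. psh_hom m T X h \<and>
        (\<forall>P\<in>paths m. \<forall>s\<in>sec S P. h P (k P s) = u P s) \<and>
        (\<forall>P\<in>paths m. \<forall>t\<in>sec T P. f P (h P t) = v P t)" by blast
  qed
  with f' show ?thesis by (simp add: trivial_fibration_def)
qed

lemma trivial_fibration_into_rho:
  "trivial_fibration m X (rho m Y) f \<longleftrightarrow> trivial_fibration m X Y f"
  by (simp add: trivial_fibration_def lifts_against_def psh_hom_into_rho)

lemma spans_rho: "spans m (rho m X) (rho m Y) = spans m X Y"
proof -
  have "subpsh (prod_psh (rho m X) (rho m Y)) W = subpsh (prod_psh X Y) W" for W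
    by (simp add: subpsh_def prod_psh_def res_rho)
  moreover have "subobject m (prod_psh (rho m X) (rho m Y)) W \<longleftrightarrow> subobject m (prod_psh X Y) W" for W
    by (simp add: subobject_def prod_psh_def sec_rho res_rho)
  ultimately show ?thesis
    by (simp add: spans_def trivial_fibration_into_rho)
qed

lemma spans_restrict_paths:
  assumes mn: "m \<le> n" and W: "W \<in> spans n X Y"
  shows "restrict_paths m W \<in> spans m X Y"
proof -
  let ?Z = "subpsh (prod_psh X Y) W"
  have "trivial_fibration n ?Z X (\<lambda>P. fst)" "trivial_fibration n ?Z Y (\<lambda>P. snd)"
    using W by (simp_all add: spans_def)
  then have "trivial_fibration m (rho m ?Z) X (\<lambda>P. fst)" "trivial_fibration m (rho m ?Z) Y (\<lambda>P. snd)"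
    using trivial_fibration_rho[OF mn] trivial_fibration_into_rho by blast+
  moreover have "subpsh (prod_psh X Y) (restrict_paths m W) = rho m ?Z"
    by (simp add: subpsh_def rho_def)
  moreover have "subobject m (prod_psh X Y) (restrict_paths m W)"
    using W by (intro subobject_restrict_paths[OF mn]) (simp add: spans_def)
  ultimately show ?thesis
    by (simp add: spans_def)
qed

theorem omega_presheaf_M_psh:
  fixes A :: "('p, 'v) kripke" and B :: "('p, 'w) kripke"
  shows "omega_presheaf (M_psh A B)"
  unfolding omega_presheaf_def
proof (intro conjI allI impI ballI Pi_I; (elim conjE)?)
  fix m n :: nat and W
  assume mn: "m \<le> n" and "W \<in> om_ob (M_psh A B) n"
  then have "restrict_paths m W \<in> spans m (emb_psh (unravel n A)) (emb_psh (unravel n B))"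
    by (intro spans_restrict_paths[OF mn]) (simp add: M_psh_def)
  then have "restrict_paths m W \<in>
      spans m (rho m (emb_psh (unravel n A))) (rho m (emb_psh (unravel n B)))"
    by (simp add: spans_rho)
  then have "restrict_paths m W \<in> spans m (emb_psh (unravel m A)) (emb_psh (unravel m B))"
    unfolding rho_unravel[OF mn] spans_rho .
  then show "om_map (M_psh A B) m n W \<in> om_ob (M_psh A B) m"
    by (simp add: M_psh_def)
next
  fix n :: nat and W
  assume "W \<in> om_ob (M_psh A B) n"
  then have "\<forall>P. P \<notin> paths n \<longrightarrow> W P = {}" by (simp add: M_psh_def spans_def subobject_def)
  then show "om_map (M_psh A B) n n W = W"
    by (intro ext) (simp add: M_psh_def restrict_paths_def)
next
  fix l m n :: nat and W
  assume lm: "l \<le> m"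
  have "P \<in> paths m" if "P \<in> paths l" for P :: "('p, nat) kripke"
    using that paths_mono[OF lm] by blast
  then show "om_map (M_psh A B) l n W = om_map (M_psh A B) l m (om_map (M_psh A B) m n W)"
    by (intro ext) (simp add: M_psh_def restrict_paths_def)
qed

end

theory Submission
  imports Defs
begin

text \<open>
  An embedding of a path into \<open>unravel n A\<close> is the family of prefixes of a single sequence, so a
  span of trivial fibrations amounts to an \<open>n\<close>-round bisimulation between \<open>A\<close> and \<open>B\<close>: lifting
  against the inclusion of a path without its last element is the one-step back and forth
  condition, and every lifting problem is solved by such steps, by recursion on height. With
  finitely many variables, an \<open>n\<close>-round bisimulation exists for every \<open>n\<close> iff \<open>A\<close> and \<open>B\<close> are
  modally equivalent. A global section is a coherent family of them, whose union is a
  bisimulation. Hence \<open>M_psh A B\<close> is strongly non-empty iff \<open>A\<close> and \<open>B\<close> are modally equivalent,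
  and it has a global section iff they are bisimilar.
\<close>

section \<open>Trivial fibrations from one-step extensions\<close>

text \<open>The converse of \<open>trivial_fibration_extend\<close>. A lift is chosen by recursion
  on height: on the image of the monomorphism it is forced to be \<open>u\<close>, elsewhere
  \<open>ext\<close> extends the value already chosen on the truncation. Every proper embedding into
  a path factors through its one-step truncation, so compatibility there gives naturality. For
  \<open>k = 0\<close> there is no truncation, as every path has an element.\<close>

lemma trivial_fibrationI:
  fixes X :: "('p, 'x) psh" and Y :: "('p, 'y) psh"
  assumes X: "presheaf n X" and f: "psh_hom n X Y f"
    and ext: "\<And>P y k x. P \<in> paths n \<Longrightarrow> height P = Suc k \<Longrightarrow> y \<in> sec Y P \<Longrightarrow>
      (0 < k \<Longrightarrow> x \<in> sec X (trunc k P)) \<Longrightarrow>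
      (0 < k \<Longrightarrow> f (trunc k P) x = res Y (trunc k P) P (restrict id {..<k}) y) \<Longrightarrow>
      \<exists>z\<in>sec X P. f P z = y \<and> (0 < k \<longrightarrow> res X (trunc k P) P (restrict id {..<k}) z = x)"
  shows "trivial_fibration n X Y f"
proof -
  have "lifts_against n S T m X Y f"
    if S: "presheaf n S" and T: "presheaf n T" and mono: "psh_mono n S T m"
    for S T :: "('p, nat \<Rightarrow> nat) psh" and m
    unfolding lifts_against_def
  proof (intro allI impI, elim conjE)
    fix u v
    assume u: "psh_hom n S X u" and v: "psh_hom n T Y v"
      and "\<forall>P\<in>paths n. \<forall>s\<in>sec S P. f P (u P s) = v P (m P s)"
    then have fu: "\<And>P s. P \<in> paths n \<Longrightarrow> s \<in> sec S P \<Longrightarrow> f P (u P s) = v P (m P s)"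
      by blast
    have m: "psh_hom n S T m" and inj: "\<And>P. P \<in> paths n \<Longrightarrow> inj_on (m P) (sec S P)"
      using mono by (auto simp: psh_mono_def)
    let ?i = "\<lambda>k. restrict id {..<k} :: nat \<Rightarrow> nat"
    \<comment> \<open>The admissible values at \<open>t\<close>: lying over \<open>v\<close>,
      agreeing with \<open>u\<close> on the image of \<open>m\<close>, and restricting to what the
      previous stage \<open>g\<close> chose on the truncation.\<close>
    define good where "good k g P t z \<longleftrightarrow> z \<in> sec X P \<and> f P z = v P t \<and>
       (\<forall>s\<in>sec S P. t = m P s \<longrightarrow> z = u P s) \<and>
       (0 < k \<longrightarrow> res X (trunc k P) P (?i k) z = g (trunc k P) (res T (trunc k P) P (?i k) t))"
      for k g P t z
    have good_u: "good k g P (m P s) (u P s)"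
      if P: "P \<in> paths n" and s: "s \<in> sec S P"
        and r: "0 < k \<Longrightarrow> res X (trunc k P) P (?i k) (u P s) =
          g (trunc k P) (res T (trunc k P) P (?i k) (m P s))"
      for k g P s
      unfolding good_def
    proof (intro conjI ballI impI)
      fix s' assume "s' \<in> sec S P" "m P s = m P s'"
      then show "u P s = u P s'" using inj_onD[OF inj[OF P], of s s'] s by simp
    qed (rule psh_hom_sec[OF u P s], rule fu[OF P s], rule r)
    \<comment> \<open>Stage \<open>g k\<close> is meant for paths of height exactly
      \<open>k\<close>. No path has height 0, so the default \<open>undefined\<close> is never
      consulted.\<close>
    define g where "g = rec_nat (\<lambda>P t. undefined) (\<lambda>k g P t. SOME z. good k g P t z)"
    have gSuc: "g (Suc k) P t = (SOME z. good k (g k) P t z)" for k P t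
      by (simp add: g_def)
    have good_g: "good k (g k) P t (g (Suc k) P t)"
      if "P \<in> paths n" "height P = Suc k" "t \<in> sec T P" for k P t
      using that
    \<comment> \<open>An admissible value at one height exists only if the choice made on the
      truncation was itself admissible, hence the induction.\<close>
    proof (induction k arbitrary: P t)
      case (0 P t)
      note P = 0(1) and t = 0(3)
      have "\<exists>z. good 0 (g 0) P t z"
      proof (cases "\<exists>s\<in>sec S P. t = m P s")
        case True
        then obtain s where s: "s \<in> sec S P" "t = m P s" by blast
        then have "good 0 (g 0) P t (u P s)" using good_u[OF P, of s 0] by simp
        then show ?thesis ..
      next
        case False
        obtain z where "z \<in> sec X P" "f P z = v P t"
          using ext[OF P 0(2) psh_hom_sec[OF v P t]] by auto
        then have "good 0 (g 0) P t z" using False by (simp add: good_def)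
        then show ?thesis ..
      qed
      then show ?case unfolding gSuc by (rule someI_ex)
    next
      case (Suc k P t)
      note P = Suc(2) and hP = Suc(3) and t = Suc(4)
      let ?P' = "trunc (Suc k) P" and ?j = "?i (Suc k)"
      let ?t' = "res T ?P' P ?j t"
      have P': "?P' \<in> paths n" by (rule trunc_paths_n[OF P]) (simp_all add: hP)
      have j: "?j \<in> embs ?P' P" by (rule trunc_embs[OF P]) (simp_all add: hP)
      have t': "?t' \<in> sec T ?P'" by (rule res_sec[OF T P' P j t])
      note IH = Suc(1)[OF P' height_trunc t', unfolded good_def]
      have "\<exists>z. good (Suc k) (g (Suc k)) P t z"
      proof (cases "\<exists>s\<in>sec S P. t = m P s")
        case True
        then obtain s where s: "s \<in> sec S P" "t = m P s" by blast
        \<comment> \<open>The truncation of \<open>t\<close> is again in the image of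
          \<open>m\<close>, so by induction the previous stage chose the value of \<open>u\<close>
          there, and naturality of \<open>u\<close> makes \<open>u P s\<close> compatible with
          it.\<close>
        have "?t' = m ?P' (res S ?P' P ?j s)"
          unfolding s(2) by (rule psh_hom_res[OF m P' P j s(1), symmetric])
        moreover have "res S ?P' P ?j s \<in> sec S ?P'" by (rule res_sec[OF S P' P j s(1)])
        ultimately have "g (Suc k) ?P' ?t' = u ?P' (res S ?P' P ?j s)"
          using IH by (elim conjE ballE[of _ _ "res S ?P' P ?j s"]) simp_all
        also have "\<dots> = res X ?P' P ?j (u P s)" by (rule psh_hom_res[OF u P' P j s(1)])
        finally have "good (Suc k) (g (Suc k)) P t (u P s)"
          unfolding s(2) by (intro good_u[OF P s(1)]) (simp add: s(2))
        then show ?thesis ..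
      next
        case False
        have "f ?P' (g (Suc k) ?P' ?t') = res Y ?P' P ?j (v P t)"
          using IH psh_hom_res[OF v P' P j t] by simp
        then obtain z where "z \<in> sec X P" "f P z = v P t"
            "res X ?P' P ?j z = g (Suc k) ?P' ?t'"
          using IH ext[OF P hP psh_hom_sec[OF v P t], of "g (Suc k) ?P' ?t'"] by auto
        then have "good (Suc k) (g (Suc k)) P t z" using False by (simp add: good_def)
        then show ?thesis ..
      qed
      then show ?case unfolding gSuc[of "Suc k"] by (rule someI_ex)
    qed
    define h where "h P = g (height P) P" for P
    have h: "good k h P t (h P t)"
      if "P \<in> paths n" "height P = Suc k" "t \<in> sec T P" for k P t
      using good_g[OF that] that(2) by (simp add: good_def h_def height_trunc)
    have Suc_height: "height P = Suc (height P - 1)" if "P \<in> paths n" for P :: "('p, nat) kripke"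
      using paths_height_pos[OF that] by simp
    \<comment> \<open>\<open>h'\<close> is \<open>h\<close> with \<open>k\<close> instantiated to
      the height minus one; it takes the premise on the path twice.\<close>
    note h' = h[OF _ Suc_height, unfolded good_def] and h = h[unfolded good_def]
    \<comment> \<open>Induction on the height of \<open>Q\<close>: an embedding into
      \<open>Q\<close> is the identity or factors through the truncation of
      \<open>Q\<close>.\<close>
    have natural: "h P (res T P Q i t) = res X P Q i (h Q t)"
      if "P \<in> paths n" "Q \<in> paths n" "i \<in> embs P Q" "t \<in> sec T Q" "height Q = Suc k" for P Q i t k
      using that
    proof (induction k arbitrary: Q t)
      case (0 Q t)
      \<comment> \<open>A proper embedding strictly raises the height, and no path has height
        0.\<close>
      have "P = Q"
        using embs_height_less[OF 0(2,1,3)] paths_height_pos[OF 0(1)] 0(5) by fastforce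
      then show ?case
        using 0 res_self[OF T 0(2) _ 0(4)] res_self[OF X 0(2), of i "h Q t"] h[OF 0(2,5,4)] by simp
    next
      case (Suc k Q t)
      note P = Suc(2) and Q = Suc(3) and i = Suc(4) and t = Suc(5) and hQ = Suc(6)
      show ?case
      proof (cases "P = Q")
        case True
        then show ?thesis
          using i res_self[OF T Q _ t] res_self[OF X Q, of i "h Q t"] h[OF Q hQ t] by simp
      next
        case False
        let ?Q' = "trunc (Suc k) Q" and ?j = "?i (Suc k)"
        have Q': "?Q' \<in> paths n" by (rule trunc_paths_n[OF Q]) (simp_all add: hQ)
        have j: "?j \<in> embs ?Q' Q" by (rule trunc_embs[OF Q]) (simp_all add: hQ)
        have i': "i \<in> embs P ?Q'"
          using embs_height_less[OF Q P i False] hQ by (intro embs_trunc[OF Q P i]) simp_all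
        have hQt: "h Q t \<in> sec X Q" using h[OF Q hQ t] by blast
        have "res X P Q i (h Q t) = res X P ?Q' i (res X ?Q' Q ?j (h Q t))"
          by (rule res_res[OF X P Q' Q i' j i hQt, symmetric])
        also have "\<dots> = res X P ?Q' i (h ?Q' (res T ?Q' Q ?j t))"
          using h[OF Q hQ t] by simp
        also have "\<dots> = h P (res T P ?Q' i (res T ?Q' Q ?j t))"
          by (rule Suc(1)[OF P Q' i' res_sec[OF T Q' Q j t] height_trunc, symmetric])
        also have "\<dots> = h P (res T P Q i t)"
          by (simp add: res_res[OF T P Q' Q i' j i t])
        finally show ?thesis by simp
      qed
    qed
    have "psh_hom n T X h"
      unfolding psh_hom_def
    proof (intro conjI ballI Pi_I)
      show "h P t \<in> sec X P" if "P \<in> paths n" "t \<in> sec T P" for P t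
        using h'[OF that(1,1,2)] by blast
    qed (rule natural[OF _ _ _ _ Suc_height])
    moreover have "h P (m P s) = u P s" if "P \<in> paths n" "s \<in> sec S P" for P s
      using h'[OF that(1,1) psh_hom_sec[OF m that]] that(2) by blast
    ultimately show "\<exists>h. psh_hom n T X h \<and>
        (\<forall>P\<in>paths n. \<forall>s\<in>sec S P. h P (m P s) = u P s) \<and>
        (\<forall>P\<in>paths n. \<forall>t\<in>sec T P. f P (h P t) = v P t)"
    proof (intro exI conjI ballI)
      show "f P (h P t) = v P t" if "P \<in> paths n" "t \<in> sec T P" for P t
        using h'[OF that(1,1,2)] by blast
    qed
  qed
  with f show ?thesis by (simp add: trivial_fibration_def)
qed

section \<open>Paths in an unravelling\<close>

lemma worlds_unravel:
  "s \<in> worlds (unravel n A) \<longleftrightarrow> s \<noteq> [] \<and> length s \<le> n \<and> set s \<subseteq> worlds A \<and> hd s = pt A \<and>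
     successively (\<lambda>x y. (x, y) \<in> acc A) s"
  and acc_unravel:
  "(s, t) \<in> acc (unravel n A) \<longleftrightarrow>
     s \<in> worlds (unravel n A) \<and> t \<in> worlds (unravel n A) \<and> (\<exists>x. t = s @ [x])"
  and val_unravel: "s \<in> val (unravel n A) p \<longleftrightarrow> s \<in> worlds (unravel n A) \<and> last s \<in> val A p"
  and pt_unravel: "pt (unravel n A) = [pt A]"
  by (simp_all add: unravel_def Let_def)

lemma unravel_take:
  assumes "s \<in> worlds (unravel n A)" "0 < k"
  shows "take k s \<in> worlds (unravel n A)"
proof -
  have "successively (\<lambda>x y. (x, y) \<in> acc A) (take k s @ drop k s)"
    using assms by (simp add: worlds_unravel)
  then have "successively (\<lambda>x y. (x, y) \<in> acc A) (take k s)"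
    unfolding successively_append_iff by blast
  with assms show ?thesis
    by (auto simp: worlds_unravel dest: in_set_takeD)
qed

lemma unravel_snoc:
  assumes "kripke_model A" "s \<in> worlds (unravel n A)" "(last s, a) \<in> acc A" "length s < n"
  shows "s @ [a] \<in> worlds (unravel n A)"
  using assms by (auto simp: worlds_unravel kripke_model_def successively_append_iff)

lemma unravel_singleton: "kripke_model A \<Longrightarrow> 0 < n \<Longrightarrow> [pt A] \<in> worlds (unravel n A)"
  by (simp add: worlds_unravel kripke_model_def)

lemma unravel_acc:
  "s \<in> worlds (unravel n A) \<Longrightarrow> Suc j < length s \<Longrightarrow> (s ! j, s ! Suc j) \<in> acc A"
  by (simp add: worlds_unravel successively_conv_nth)

text \<open>For \<open>s\<close> in the unravelling, the object of the skeleton isomorphic to the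
  chain of non-empty prefixes of \<open>s\<close>.\<close>

definition path_of :: "('p, 'w) kripke \<Rightarrow> 'w list \<Rightarrow> ('p, nat) kripke" where
  "path_of A s = \<lparr>worlds = {..<length s}, acc = {(j, Suc j) | j. Suc j < length s},
     val = (\<lambda>p. {j. j < length s \<and> s ! j \<in> val A p}), pt = 0\<rparr>"

text \<open>The root of an unravelling is a one-element sequence, so position \<open>j\<close> goes
  to the prefix of length \<open>Suc j\<close>. The restricted domain makes the function
  extensional, as \<open>embs\<close> demands.\<close>

definition prefixes :: "'w list \<Rightarrow> nat \<Rightarrow> 'w list" where
  "prefixes s = (\<lambda>j\<in>{..<length s}. take (Suc j) s)"

lemma worlds_path_of: "worlds (path_of A s) = {..<length s}"
  by (simp add: path_of_def)

lemma path_of_paths: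
  assumes "s \<noteq> []" "length s \<le> n"
  shows "path_of A s \<in> paths n"
proof -
  have "kripke_model (path_of A s)" using assms by (auto simp: path_of_def kripke_model_def)
  then have "is_path (path_of A s)"
    by (rule successor_path) (simp_all add: path_of_def)
  with assms show ?thesis by (simp add: paths_def path_of_def)
qed

lemma path_of_eq_length: "path_of A s = path_of B t \<Longrightarrow> length s = length t"
  by (metis worlds_path_of card_lessThan)

lemma path_of_eqI:
  assumes "length s = length t" "\<And>j p. j < length s \<Longrightarrow> s ! j \<in> val A p \<longleftrightarrow> t ! j \<in> val B p"
  shows "path_of A s = path_of B t"
  using assms by (auto simp: path_of_def)

lemma path_of_eqD: "path_of A s = path_of B t \<Longrightarrow> j < length s \<Longrightarrow> s ! j \<in> val A p \<longleftrightarrow> t ! j \<in> val B p"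
  by (auto simp: path_of_def dest!: fun_cong[of _ _ p])

lemma trunc_path_of: "k \<le> length s \<Longrightarrow> trunc k (path_of A s) = path_of A (take k s)"
  by (auto simp: trunc_def path_of_def)

text \<open>Restriction in \<open>emb_psh\<close> along the inclusion of a truncation amounts to
  cutting the sequence.\<close>

lemma compose_prefixes:
  "k \<le> length s \<Longrightarrow> compose {..<k} (prefixes s) (restrict id {..<k}) = prefixes (take k s)"
  by (intro ext) (auto simp: compose_def prefixes_def min_def)

text \<open>The value at the last position is the whole sequence.\<close>

lemma prefixes_inject:
  assumes "prefixes s = prefixes t" "length s = length t"
  shows "s = t"
proof (cases "s = []")
  case False
  then have "length s - 1 < length s" by simp
  then have "prefixes s (length s - 1) = s" "prefixes t (length s - 1) = t"
    using assms(2) by (simp_all add: prefixes_def)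
  with assms show ?thesis by simp
qed (use assms in simp)

lemma last_take_Suc: "j < length s \<Longrightarrow> last (take (Suc j) s) = s ! j"
  by (simp add: take_Suc_conv_app_nth)

lemma prefixes_embs:
  assumes s: "s \<in> worlds (unravel n A)"
  shows "prefixes s \<in> embs (path_of A s) (unravel n A)"
proof -
  have "s \<noteq> []" using s by (simp add: worlds_unravel)
  moreover have "take (Suc 0) s = [pt A]"
    using s by (cases s) (auto simp: worlds_unravel)
  moreover have "\<exists>a. take (Suc (Suc j)) s = take (Suc j) s @ [a]" if "Suc j < length s" for j
    using take_Suc_conv_app_nth[OF that] by blast
  ultimately show ?thesis
    unfolding embs_def pathwise_embedding_def kripke_hom_def
    using unravel_take[OF s]
    by (auto simp: prefixes_def path_of_def acc_unravel val_unravel pt_unravel last_take_Suc)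
qed

text \<open>Each accessibility step in the unravelling appends one element, so an embedding is
  determined by its value at the top of the path, and the path by the valuation along that
  sequence.\<close>

lemma embs_unravelE:
  assumes P: "P \<in> paths m" and x: "x \<in> embs P (unravel n A)"
  obtains s where "s \<in> worlds (unravel n A)" "P = path_of A s" "x = prefixes s"
proof -
  note W = paths_in_worlds[OF P] and R = paths_acc[OF P]
  have hom: "kripke_hom P (unravel n A) x"
    and val: "\<And>p j. j \<in> worlds P \<Longrightarrow> x j \<in> val (unravel n A) p \<longleftrightarrow> j \<in> val P p"
    using x by (auto simp: embs_def pathwise_embedding_def kripke_hom_def)
  have step: "\<exists>a. x (Suc j) = x j @ [a]" if "Suc j < height P" for j
    using hom that R unfolding kripke_hom_def acc_unravel by blast
  \<comment> \<open>Recording all earlier values as prefixes lets the value at the top recover the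
    rest.\<close>
  have len: "length (x j) = Suc j \<and> (\<forall>i\<le>j. take (Suc i) (x j) = x i)" if "j < height P" for j
    using that
  proof (induction j)
    case 0
    then show ?case using hom paths_pt[OF P] by (simp add: kripke_hom_def pt_unravel)
  next
    case (Suc j)
    then show ?case using step[of j] by (auto simp: le_Suc_eq)
  qed
  define s where "s = x (height P - 1)"
  have last: "height P - 1 < height P" using paths_height_pos[OF P] by simp
  have length: "length s = height P" using len[OF last] last by (simp add: s_def)
  have take: "x j = take (Suc j) s" if "j < height P" for j
    using len[OF last] that by (simp add: s_def)
  have s: "s \<in> worlds (unravel n A)"
    using hom last W unfolding s_def kripke_hom_def by blast
  have "x = prefixes s"
  proof
    show "x j = prefixes s j" for j
      using take[of j] x W[of j] length by (auto simp: prefixes_def embs_def extensional_def)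
  qed
  moreover have "P = path_of A s"
  proof (rule paths_eqI[OF P path_of_paths[of s "length s"]])
    show "height P = height (path_of A s)" by (simp add: worlds_path_of length)
    fix p
    have "val P p \<subseteq> worlds P" using paths_model[OF P] by (simp add: kripke_model_def)
    moreover have "j \<in> val P p \<longleftrightarrow> s ! j \<in> val A p" if "j < height P" for j
      using val[of j p] W[of j] that take[OF that] unravel_take[OF s] length
      by (simp add: val_unravel last_take_Suc)
    ultimately show "val P p = val (path_of A s) p"
      using W length by (auto simp: path_of_def)
  qed (use s in \<open>simp_all add: worlds_unravel\<close>)
  ultimately show ?thesis using that s by blast
qed

section \<open>Spans as stepwise bisimulations\<close>

text \<open>
  A bisimulation game of \<open>n\<close> rounds, the zeroth of which chooses the distinguished elements;
  \<open>Z j\<close> holds the pairs that may be visited in round \<open>j\<close>.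
\<close>

definition stepwise_bisim ::
  "nat \<Rightarrow> ('p, 'v) kripke \<Rightarrow> ('p, 'w) kripke \<Rightarrow> (nat \<Rightarrow> ('v \<times> 'w) set) \<Rightarrow> bool" where
  "stepwise_bisim n A B Z \<longleftrightarrow>
     (0 < n \<longrightarrow> (pt A, pt B) \<in> Z 0) \<and>
     (\<forall>j<n. \<forall>a b. (a, b) \<in> Z j \<longrightarrow>
        (\<forall>p. a \<in> val A p \<longleftrightarrow> b \<in> val B p) \<and>
        (Suc j < n \<longrightarrow>
           (\<forall>a'. (a, a') \<in> acc A \<longrightarrow> (\<exists>b'. (b, b') \<in> acc B \<and> (a', b') \<in> Z (Suc j))) \<and>
           (\<forall>b'. (b, b') \<in> acc B \<longrightarrow> (\<exists>a'. (a, a') \<in> acc A \<and> (a', b') \<in> Z (Suc j)))))"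

lemma stepwise_bisimD:
  assumes "stepwise_bisim n A B Z"
  shows "0 < n \<Longrightarrow> (pt A, pt B) \<in> Z 0"
    "j < n \<Longrightarrow> (a, b) \<in> Z j \<Longrightarrow> a \<in> val A p \<longleftrightarrow> b \<in> val B p"
    "Suc j < n \<Longrightarrow> (a, b) \<in> Z j \<Longrightarrow> (a, a') \<in> acc A \<Longrightarrow> \<exists>b'. (b, b') \<in> acc B \<and> (a', b') \<in> Z (Suc j)"
    "Suc j < n \<Longrightarrow> (a, b) \<in> Z j \<Longrightarrow> (b, b') \<in> acc B \<Longrightarrow> \<exists>a'. (a, a') \<in> acc A \<and> (a', b') \<in> Z (Suc j)"
  using assms Suc_lessD unfolding stepwise_bisim_def by blast+

text \<open>Lets \<open>span_of_extend\<close>, which only plays forth, serve for the back direction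
  as well.\<close>

lemma stepwise_bisim_converse:
  "stepwise_bisim n A B Z \<Longrightarrow> stepwise_bisim n B A (\<lambda>j. (Z j)\<inverse>)"
  unfolding stepwise_bisim_def by simp

section \<open>From stepwise bisimulations to spans\<close>

text \<open>The elements are plays of the game: parallel runs from the two roots that stay in
  \<open>Z\<close>. Both runs must have shape \<open>P\<close>, so that both prefix families live at
  the same object.\<close>

definition span_of ::
  "nat \<Rightarrow> ('p, 'v) kripke \<Rightarrow> ('p, 'w) kripke \<Rightarrow> (nat \<Rightarrow> ('v \<times> 'w) set) \<Rightarrow>
   ('p, nat) kripke \<Rightarrow> ((nat \<Rightarrow> 'v list) \<times> (nat \<Rightarrow> 'w list)) set" where
  "span_of n A B Z P =
     {(prefixes s, prefixes t) | s t.
        s \<in> worlds (unravel n A) \<and> t \<in> worlds (unravel n B) \<and> P = path_of A s \<and> P = path_of B t \<and>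
        (\<forall>j<length s. (s ! j, t ! j) \<in> Z j)}"

lemma span_ofI:
  assumes "s \<in> worlds (unravel n A)" "t \<in> worlds (unravel n B)" "path_of A s = path_of B t"
    "\<And>j. j < length s \<Longrightarrow> (s ! j, t ! j) \<in> Z j"
  shows "(prefixes s, prefixes t) \<in> span_of n A B Z (path_of A s)"
  unfolding span_of_def using assms by blast

lemma span_ofE:
  assumes "(x, y) \<in> span_of n A B Z P"
  obtains s t where "x = prefixes s" "y = prefixes t" "P = path_of A s"
    "s \<in> worlds (unravel n A)" "t \<in> worlds (unravel n B)" "path_of A s = path_of B t"
    "length t = length s" "\<And>j. j < length s \<Longrightarrow> (s ! j, t ! j) \<in> Z j"
proof -
  obtain s t where xy: "x = prefixes s" "y = prefixes t" and P: "P = path_of A s" "P = path_of B t"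
    and st: "s \<in> worlds (unravel n A)" "t \<in> worlds (unravel n B)"
    and Z: "\<forall>j<length s. (s ! j, t ! j) \<in> Z j"
    using assms unfolding span_of_def by blast
  have eq: "path_of A s = path_of B t" using P by simp
  show ?thesis
  proof (rule that[OF xy P(1) st eq])
    show "length t = length s" using path_of_eq_length[OF eq] by simp
    show "(s ! j, t ! j) \<in> Z j" if "j < length s" for j using Z that by blast
  qed
qed

lemma span_of_swap:
  assumes "(x, y) \<in> span_of n A B Z P"
  shows "(y, x) \<in> span_of n B A (\<lambda>j. (Z j)\<inverse>) P"
  using assms
proof (rule span_ofE)
  fix s t assume "x = prefixes s" "y = prefixes t" "P = path_of A s" "path_of A s = path_of B t"
    "s \<in> worlds (unravel n A)" "t \<in> worlds (unravel n B)" "length t = length s"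
    "\<And>j. j < length s \<Longrightarrow> (s ! j, t ! j) \<in> Z j"
  then show ?thesis using span_ofI[of t n B s A "\<lambda>j. (Z j)\<inverse>"] by simp
qed

lemma span_of_converse:
  "(y, x) \<in> span_of n B A (\<lambda>j. (Z j)\<inverse>) P \<longleftrightarrow> (x, y) \<in> span_of n A B Z P"
  using span_of_swap[of x y n A B Z P] span_of_swap[of y x n B A "\<lambda>j. (Z j)\<inverse>" P] by auto

text \<open>Restriction along an embedding of paths cuts both runs to the same length, and initial
  segments of parallel runs are parallel runs.\<close>

lemma subobject_span_of:
  "subobject n (prod_psh (emb_psh (unravel n A)) (emb_psh (unravel n B))) (span_of n A B Z)"
  unfolding subobject_def
proof (intro conjI ballI allI impI Pi_I)
  show "span_of n A B Z P \<subseteq> sec (prod_psh (emb_psh (unravel n A)) (emb_psh (unravel n B))) P" for P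
    using prefixes_embs by (auto simp: prod_psh_def emb_psh_def elim!: span_ofE) (metis prefixes_embs)
  show "span_of n A B Z P = {}" if "P \<notin> paths n" for P
    using that path_of_paths[of _ n B] by (auto simp: worlds_unravel elim!: span_ofE)
next
  fix P Q i z
  assume P: "P \<in> paths n" and Q: "Q \<in> paths n" and i: "i \<in> embs P Q" and z: "z \<in> span_of n A B Z Q"
  from z obtain s t where z: "z = (prefixes s, prefixes t)" and s: "s \<in> worlds (unravel n A)"
    and t: "t \<in> worlds (unravel n B)" and Qs: "Q = path_of A s" and Qt: "Q = path_of B t"
    and Z: "\<forall>j<length s. (s ! j, t ! j) \<in> Z j"
    by (auto simp: span_of_def)
  define k where "k = height P"
  have k: "0 < k" "k \<le> length s" "length t = length s"
    using paths_height_pos[OF P] embs_paths(2)[OF P Q i] path_of_eq_length Qs Qt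
    by (auto simp: k_def worlds_path_of)
  have "P = trunc k Q" unfolding k_def by (rule embs_eq_trunc[OF P Q i])
  then have Ps: "P = path_of A (take k s)" "P = path_of B (take k t)"
    using trunc_path_of[of k s A] trunc_path_of[of k t B] k Qs Qt by metis+
  have W: "worlds P = {..<k}" using paths_worlds[OF P] by (simp add: k_def)
  have "res (prod_psh (emb_psh (unravel n A)) (emb_psh (unravel n B))) P Q i z =
      (prefixes (take k s), prefixes (take k t))"
    using k by (simp add: z prod_psh_def emb_psh_def embs_paths(1)[OF P Q i] W compose_prefixes)
  then show "res (prod_psh (emb_psh (unravel n A)) (emb_psh (unravel n B))) P Q i z \<in> span_of n A B Z P"
    using span_ofI[OF unravel_take[OF s k(1)] unravel_take[OF t k(1)], of Z] Ps Z k(2) by simp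
qed

text \<open>Given a partner of \<open>s\<close> without its last element, the forth clause of
  \<open>Z\<close> answers the last move of \<open>s\<close>.\<close>

lemma span_of_extend:
  assumes Z: "stepwise_bisim n A B Z" and B: "kripke_model B"
    and s: "s \<in> worlds (unravel n A)" "length s = Suc k"
    and y: "0 < k \<Longrightarrow> (prefixes (take k s), y) \<in> span_of n A B Z (path_of A (take k s))"
  obtains z where "(prefixes s, z) \<in> span_of n A B Z (path_of A s)"
    "0 < k \<Longrightarrow> compose {..<k} z (restrict id {..<k}) = y"
proof -
  have kn: "k < n" using s by (simp add: worlds_unravel)
  obtain t where t: "t \<in> worlds (unravel n B)" "length t = Suc k"
    and st: "\<forall>j<Suc k. (s ! j, t ! j) \<in> Z j" and y: "0 < k \<Longrightarrow> y = prefixes (take k t)"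
  proof (cases "k = 0")
    case True
    \<comment> \<open>A one-element sequence is the root, so the partner is the other root;
      \<open>y\<close> gives no information here.\<close>
    with s have "s = [pt A]" by (cases s) (auto simp: worlds_unravel)
    with True that[of "[pt B]"] kn unravel_singleton[OF B, of n] stepwise_bisimD(1)[OF Z]
    show ?thesis by simp
  next
    case False
    then obtain s0 t0 where "prefixes (take k s) = prefixes s0" and y: "y = prefixes t0"
      and "s0 \<in> worlds (unravel n A)" and t0: "t0 \<in> worlds (unravel n B)"
      and eq: "path_of A (take k s) = path_of A s0" "path_of A (take k s) = path_of B t0"
      and st: "\<forall>j<length s0. (s0 ! j, t0 ! j) \<in> Z j"
      using y by (auto simp: span_of_def)
    moreover have l: "length s0 = k" "length t0 = k"
      using path_of_eq_length[OF eq(1)] path_of_eq_length[OF eq(2)] s by simp_all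
    \<comment> \<open>Membership of the pair in the span only yields some run \<open>s0\<close> with
      the same prefixes; injectivity identifies it.\<close>
    ultimately have "s0 = take k s" using prefixes_inject[of "take k s" s0] s by simp
    with st l have st: "\<forall>j<k. (s ! j, t0 ! j) \<in> Z j" by simp
    \<comment> \<open>\<open>l\<close> is the last round already played, and the move to answer
      leads from round \<open>l\<close> to round \<open>Suc l\<close>.\<close>
    obtain l where k: "k = Suc l" using False not0_implies_Suc by blast
    have "(s ! l, s ! Suc l) \<in> acc A" by (rule unravel_acc[OF s(1)]) (simp add: s k)
    moreover have "(s ! l, t0 ! l) \<in> Z l" using st k by simp
    ultimately obtain b where b: "(t0 ! l, b) \<in> acc B" "(s ! Suc l, b) \<in> Z (Suc l)"
      using stepwise_bisimD(3)[OF Z, of l] kn k by blast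
    have "t0 ! l = last t0" using \<open>length t0 = k\<close> k by (simp add: last_conv_nth flip: length_greater_0_conv)
    with b have "t0 @ [b] \<in> worlds (unravel n B)"
      using unravel_snoc[OF B t0, of b] \<open>length t0 = k\<close> kn by simp
    moreover have "\<forall>j<Suc k. (s ! j, (t0 @ [b]) ! j) \<in> Z j"
      using st b(2) \<open>length t0 = k\<close> by (auto simp: nth_append less_Suc_eq k)
    ultimately show ?thesis
      using that[of "t0 @ [b]"] \<open>length t0 = k\<close> y by simp
  qed
  \<comment> \<open>The two runs have the same shape because pairs in \<open>Z\<close> agree on
    propositional variables.\<close>
  have "path_of A s = path_of B t"
  proof (rule path_of_eqI)
    show "s ! j \<in> val A p \<longleftrightarrow> t ! j \<in> val B p" if "j < length s" for j p
      using stepwise_bisimD(2)[OF Z, of j "s ! j" "t ! j" p] that s(2) st kn by simp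
  qed (simp add: s t)
  with s t st have "(prefixes s, prefixes t) \<in> span_of n A B Z (path_of A s)"
    by (intro span_ofI) simp_all
  then show ?thesis
    by (rule that) (use t y in \<open>simp add: compose_prefixes\<close>)
qed

text \<open>A one-step lifting problem for a projection is a run in one model together with a
  partner for all but its last element. \<open>span_of_extend\<close> solves it, for the second
  projection with the roles of the models exchanged.\<close>

lemma span_of_spans:
  assumes A: "kripke_model A" and B: "kripke_model B" and Z: "stepwise_bisim n A B Z"
  shows "span_of n A B Z \<in> spans n (emb_psh (unravel n A)) (emb_psh (unravel n B))"
proof -
  let ?A = "emb_psh (unravel n A)" and ?B = "emb_psh (unravel n B)"
  let ?X = "subpsh (prod_psh ?A ?B) (span_of n A B Z)"
  have X: "presheaf n ?X"
    by (intro presheaf_subpsh presheaf_prod_psh presheaf_emb_psh subobject_span_of)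
  have sec: "sec ?X P = span_of n A B Z P" for P by (simp add: subpsh_def)
  have res: "res ?X P Q i = map_prod (\<lambda>x. compose (worlds P) x i) (\<lambda>x. compose (worlds P) x i)"
    for P Q i by (simp add: subpsh_def prod_psh_def emb_psh_def)
  have W: "worlds (trunc k P) = {..<k}" for k P by (simp add: trunc_def)
  have sub: "span_of n A B Z P \<subseteq> embs P (unravel n A) \<times> embs P (unravel n B)" if "P \<in> paths n" for P
    using subobject_span_of[of n A B Z] that
    by (simp add: subobject_def prod_psh_def emb_psh_def)
  have "psh_hom n ?X ?A (\<lambda>P. fst)" "psh_hom n ?X ?B (\<lambda>P. snd)"
    unfolding psh_hom_def sec res using sub by (fastforce simp: emb_psh_def)+
  moreover have "trivial_fibration n ?X ?A (\<lambda>P. fst)"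
  proof (rule trivial_fibrationI[OF X \<open>psh_hom n ?X ?A (\<lambda>P. fst)\<close>])
    fix P y k x
    assume P: "P \<in> paths n" "height P = Suc k" and "y \<in> sec ?A P"
      and x: "0 < k \<Longrightarrow> x \<in> sec ?X (trunc k P)"
        "0 < k \<Longrightarrow> fst x = res ?A (trunc k P) P (restrict id {..<k}) y"
    then obtain s where s: "s \<in> worlds (unravel n A)" "P = path_of A s" "y = prefixes s"
      by (auto simp: emb_psh_def elim: embs_unravelE[OF P(1)])
    have l: "length s = Suc k" using P(2) by (simp add: s worlds_path_of)
    \<comment> \<open>\<open>x\<close> lies over the restriction of \<open>y\<close>, so its first
      component consists of the prefixes of the shortened run.\<close>
    have "(prefixes (take k s), snd x) \<in> span_of n A B Z (path_of A (take k s))" if "0 < k"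
      using x[OF that] l unfolding sec s(2,3)
      by (cases x) (simp add: emb_psh_def W trunc_path_of compose_prefixes worlds_path_of)
    from span_of_extend[OF Z B s(1) l this]
    obtain z where z: "(prefixes s, z) \<in> span_of n A B Z (path_of A s)"
      and r: "0 < k \<Longrightarrow> compose {..<k} z (restrict id {..<k}) = snd x" by blast
    show "\<exists>z\<in>sec ?X P. fst z = y \<and>
        (0 < k \<longrightarrow> res ?X (trunc k P) P (restrict id {..<k}) z = x)"
      using z r x(2) unfolding sec res s(2,3)
      by (intro bexI[of _ "(prefixes s, z)"]) (auto simp: W emb_psh_def prod_eq_iff)
  qed
  moreover have "trivial_fibration n ?X ?B (\<lambda>P. snd)"
  proof (rule trivial_fibrationI[OF X \<open>psh_hom n ?X ?B (\<lambda>P. snd)\<close>])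
    fix P y k x
    assume P: "P \<in> paths n" "height P = Suc k" and "y \<in> sec ?B P"
      and x: "0 < k \<Longrightarrow> x \<in> sec ?X (trunc k P)"
        "0 < k \<Longrightarrow> snd x = res ?B (trunc k P) P (restrict id {..<k}) y"
    then obtain s where s: "s \<in> worlds (unravel n B)" "P = path_of B s" "y = prefixes s"
      by (auto simp: emb_psh_def elim: embs_unravelE[OF P(1)])
    have l: "length s = Suc k" using P(2) by (simp add: s worlds_path_of)
    have "(prefixes (take k s), fst x) \<in> span_of n B A (\<lambda>j. (Z j)\<inverse>) (path_of B (take k s))"
      if "0 < k"
      using x[OF that] l unfolding sec s(2,3) span_of_converse
      by (cases x) (simp add: emb_psh_def W trunc_path_of compose_prefixes worlds_path_of)
    from span_of_extend[OF stepwise_bisim_converse[OF Z] A s(1) l this]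
    obtain z where z: "(z, prefixes s) \<in> span_of n A B Z (path_of B s)"
      and r: "0 < k \<Longrightarrow> compose {..<k} z (restrict id {..<k}) = fst x"
      unfolding span_of_converse by blast
    show "\<exists>z\<in>sec ?X P. snd z = y \<and>
        (0 < k \<longrightarrow> res ?X (trunc k P) P (restrict id {..<k}) z = x)"
      using z r x(2) unfolding sec res s(2,3)
      by (intro bexI[of _ "(z, prefixes s)"]) (auto simp: W emb_psh_def prod_eq_iff)
  qed
  ultimately show ?thesis
    unfolding spans_def using subobject_span_of by blast
qed

section \<open>From spans to stepwise bisimulations\<close>

text \<open>On a path of height \<open>Suc j\<close> the top position is \<open>j\<close>; the value
  there is a whole run, and its last element is the world visited in round \<open>j\<close>.\<close>

definition trace :: "(('p, nat) kripke \<Rightarrow> ((nat \<Rightarrow> 'v list) \<times> (nat \<Rightarrow> 'w list)) set) \<Rightarrow> nat \<Rightarrow> ('v \<times> 'w) set"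
  where "trace W j = {(last (x j), last (y j)) | x y. \<exists>P. height P = Suc j \<and> (x, y) \<in> W P}"

lemma spans_presheaf:
  assumes "presheaf n X" "presheaf n Y" "W \<in> spans n X Y"
  shows "presheaf n (subpsh (prod_psh X Y) W)"
  using assms by (intro presheaf_subpsh presheaf_prod_psh) (simp_all add: spans_def)

text \<open>\<open>W\<close> is empty away from \<open>paths n\<close>, so both components of
  \<open>z\<close> are embeddings of one path and \<open>embs_unravelE\<close> applies to
  each.\<close>

lemma spans_prefixesE:
  assumes W: "W \<in> spans n (emb_psh (unravel n A)) (emb_psh (unravel n B))" and z: "z \<in> W P"
  obtains s t where "s \<in> worlds (unravel n A)" "t \<in> worlds (unravel n B)"
    "z = (prefixes s, prefixes t)" "P = path_of A s" "path_of A s = path_of B t"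
proof -
  have sub: "subobject n (prod_psh (emb_psh (unravel n A)) (emb_psh (unravel n B))) W"
    using W by (simp add: spans_def)
  then have P: "P \<in> paths n" using z unfolding subobject_def by blast
  with sub z have "z \<in> embs P (unravel n A) \<times> embs P (unravel n B)"
    unfolding subobject_def prod_psh_def emb_psh_def by auto
  then have z': "fst z \<in> embs P (unravel n A)" "snd z \<in> embs P (unravel n B)" by auto
  obtain s where s: "s \<in> worlds (unravel n A)" "P = path_of A s" "fst z = prefixes s"
    using embs_unravelE[OF P z'(1)] by blast
  obtain t where t: "t \<in> worlds (unravel n B)" "P = path_of B t" "snd z = prefixes t"
    using embs_unravelE[OF P z'(2)] by blast
  show ?thesis
    by (rule that[OF s(1) t(1) _ s(2)]) (use s t in \<open>auto simp: prod_eq_iff\<close>)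
qed

lemma traceE:
  assumes W: "W \<in> spans n (emb_psh (unravel n A)) (emb_psh (unravel n B))" and "(a, b) \<in> trace W j"
  obtains s t where "s \<in> worlds (unravel n A)" "t \<in> worlds (unravel n B)"
    "(prefixes s, prefixes t) \<in> W (path_of A s)" "path_of A s = path_of B t"
    "length s = Suc j" "length t = Suc j" "a = last s" "b = last t"
proof -
  from assms(2) obtain x y P where P: "height P = Suc j" and xy: "(x, y) \<in> W P"
    and ab: "a = last (x j)" "b = last (y j)"
    unfolding trace_def by blast
  obtain s t where s: "s \<in> worlds (unravel n A)" and t: "t \<in> worlds (unravel n B)"
    and "(x, y) = (prefixes s, prefixes t)" and Ps: "P = path_of A s" and eq: "path_of A s = path_of B t"
    using spans_prefixesE[OF W xy] by blast
  then have xy': "x = prefixes s" "y = prefixes t" by simp_all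
  have l: "length s = Suc j" "length t = Suc j"
    using P path_of_eq_length[OF eq] by (simp_all add: Ps worlds_path_of)
  show ?thesis
    by (rule that[OF s t _ eq l]) (use xy ab l in \<open>simp_all add: xy' Ps prefixes_def\<close>)
qed

lemma traceI:
  assumes "(prefixes s, prefixes t) \<in> W (path_of A s)" "length s = Suc j" "length t = Suc j"
  shows "(last s, last t) \<in> trace W j"
  unfolding trace_def using assms
  by (intro CollectI exI[of _ "prefixes s"] exI[of _ "prefixes t"] conjI exI[of _ "path_of A s"])
    (simp_all add: prefixes_def worlds_path_of)

text \<open>The path of \<open>s @ [a]\<close> truncates to the path of \<open>s\<close>, so lifting
  against this inclusion lifts the move from \<open>last s\<close> to \<open>a\<close>.\<close>

lemma trivial_fibration_step:
  assumes A: "kripke_model A" and X: "presheaf n X"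
    and tf: "trivial_fibration n X (emb_psh (unravel n A)) f"
    and s: "s \<in> worlds (unravel n A)" and a: "(last s, a) \<in> acc A" and l: "length s < n"
    and z: "z \<in> sec X (path_of A s)" "f (path_of A s) z = prefixes s"
  obtains z' where "z' \<in> sec X (path_of A (s @ [a]))"
    "f (path_of A (s @ [a])) z' = prefixes (s @ [a])"
    "res X (path_of A s) (path_of A (s @ [a])) (restrict id {..<length s}) z' = z"
proof -
  let ?P = "path_of A (s @ [a])"
  have sa: "s @ [a] \<in> worlds (unravel n A)" by (rule unravel_snoc[OF A s a l])
  have P: "?P \<in> paths n" using l by (intro path_of_paths) simp_all
  have k: "height ?P - 1 = length s" by (simp add: worlds_path_of)
  have trunc: "trunc (length s) ?P = path_of A s" by (simp add: trunc_path_of)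
  have "0 < length s" using s by (simp add: worlds_unravel)
  moreover have "prefixes (s @ [a]) \<in> sec (emb_psh (unravel n A)) ?P"
    using prefixes_embs[OF sa] by (simp add: emb_psh_def)
  moreover have "f (path_of A s) z =
      res (emb_psh (unravel n A)) (path_of A s) ?P (restrict id {..<length s}) (prefixes (s @ [a]))"
    using z(2) compose_prefixes[of "length s" "s @ [a]"] by (simp add: emb_psh_def worlds_path_of)
  ultimately show ?thesis
    using trivial_fibration_extend[OF X presheaf_emb_psh tf P, unfolded k trunc, of _ z] z(1) that
    by metis
qed

text \<open>Reads the reply off the other leg of a lifted section: its restriction shows that
  \<open>t'\<close> prolongs \<open>t\<close> by one element.\<close>

lemma prefixes_extend:
  assumes t': "t' \<in> worlds (unravel n B)" "length t' = Suc (length t)" and "t \<noteq> []"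
    and "compose {..<length t} (prefixes t') (restrict id {..<length t}) = prefixes t"
  obtains b where "t' = t @ [b]" "(last t, b) \<in> acc B"
proof -
  have "prefixes (take (length t) t') = prefixes t"
    using assms compose_prefixes[of "length t" t'] by simp
  then have "take (length t) t' = t"
    using t'(2) by (intro prefixes_inject) simp_all
  then have eq: "t' = t @ [t' ! length t]"
    using t'(2) take_Suc_conv_app_nth[of "length t" t'] by simp
  moreover have "successively (\<lambda>x y. (x, y) \<in> acc B) (t @ [t' ! length t])"
    using t'(1) eq by (simp add: worlds_unravel)
  then have "(last t, t' ! length t) \<in> acc B"
    using \<open>t \<noteq> []\<close> by (simp add: successively_append_iff)
  ultimately show ?thesis by (rule that)
qed

text \<open>A move in one model is lifted through the projection to that model, and the other
  component of the lift contains the reply.\<close>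

lemma stepwise_bisim_trace:
  assumes A: "kripke_model A" and B: "kripke_model B"
    and W: "W \<in> spans n (emb_psh (unravel n A)) (emb_psh (unravel n B))"
  shows "stepwise_bisim n A B (trace W)"
proof -
  let ?X = "subpsh (prod_psh (emb_psh (unravel n A)) (emb_psh (unravel n B))) W"
  have X: "presheaf n ?X" by (rule spans_presheaf[OF presheaf_emb_psh presheaf_emb_psh W])
  have tfA: "trivial_fibration n ?X (emb_psh (unravel n A)) (\<lambda>P. fst)"
    and tfB: "trivial_fibration n ?X (emb_psh (unravel n B)) (\<lambda>P. snd)"
    using W by (simp_all add: spans_def)
  have sec: "sec ?X P = W P" for P by (simp add: subpsh_def)
  have res: "res ?X (path_of C s) Q i =
      map_prod (\<lambda>x. compose {..<length s} x i) (\<lambda>x. compose {..<length s} x i)"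
    for C :: "('a, 'd) kripke" and s Q i
    by (simp add: subpsh_def prod_psh_def emb_psh_def worlds_path_of)
  \<comment> \<open>Lifting at a path of height 1, where nothing is prescribed beforehand.\<close>
  have root: "(pt A, pt B) \<in> trace W 0" if "0 < n"
  proof -
    let ?P = "path_of A [pt A]"
    have P: "?P \<in> paths n" using that by (intro path_of_paths) simp_all
    have k: "height ?P - 1 = 0" by (simp add: worlds_path_of)
    have "prefixes [pt A] \<in> sec (emb_psh (unravel n A)) ?P"
      using prefixes_embs[OF unravel_singleton[OF A that]] by (simp add: emb_psh_def)
    from trivial_fibration_extend[OF X presheaf_emb_psh tfA P this, unfolded k sec]
    obtain z where z: "z \<in> W ?P" "fst z = prefixes [pt A]" by blast
    obtain s t where st: "t \<in> worlds (unravel n B)" "z = (prefixes s, prefixes t)"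
      "?P = path_of A s" "path_of A s = path_of B t"
      using spans_prefixesE[OF W z(1)] by blast
    have "length t = Suc 0" using path_of_eq_length[of A "[pt A]" B t] st(3,4) by simp
    moreover from this have "t = [pt B]" using st(1) by (cases t) (auto simp: worlds_unravel)
    ultimately show ?thesis
      using traceI[of "[pt A]" t W A 0] z st(2) by simp
  qed
  \<comment> \<open>The two runs have the same shape, and its valuation records the variables at
    every position.\<close>
  have atoms: "a \<in> val A p \<longleftrightarrow> b \<in> val B p" if ab: "(a, b) \<in> trace W j" for a b j p
  proof -
    obtain s t where st: "path_of A s = path_of B t" "length s = Suc j" "length t = Suc j"
      "a = last s" "b = last t" using traceE[OF W ab] by blast
    then have "a = s ! j" "b = t ! j" by (simp_all add: last_conv_nth flip: length_greater_0_conv)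
    then show ?thesis using path_of_eqD[OF st(1)] st(2) by simp
  qed
  have forth: "\<exists>b'. (b, b') \<in> acc B \<and> (a', b') \<in> trace W (Suc j)"
    if ab: "(a, b) \<in> trace W j" and j: "Suc j < n" and a': "(a, a') \<in> acc A" for a b j a'
  proof -
    obtain s t where s: "s \<in> worlds (unravel n A)"
      and xy: "(prefixes s, prefixes t) \<in> W (path_of A s)"
      and l: "length s = Suc j" "length t = Suc j" and ab: "a = last s" "b = last t"
      using traceE[OF W ab] by blast
    obtain z' where z': "z' \<in> W (path_of A (s @ [a']))" "fst z' = prefixes (s @ [a'])"
      and r: "res ?X (path_of A s) (path_of A (s @ [a'])) (restrict id {..<length s}) z' =
        (prefixes s, prefixes t)"
      using trivial_fibration_step[OF A X tfA s a'[unfolded ab(1)], of "(prefixes s, prefixes t)"] j l xy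
      unfolding sec by auto
    obtain s' t' where st': "t' \<in> worlds (unravel n B)" "z' = (prefixes s', prefixes t')"
      "path_of A (s @ [a']) = path_of A s'" "path_of A s' = path_of B t'"
      using spans_prefixesE[OF W z'(1)] by blast
    have len: "length t' = Suc (length t)"
      using path_of_eq_length[of A "s @ [a']" B t'] st'(3,4) l by simp
    have comp: "compose {..<length t} (prefixes t') (restrict id {..<length t}) = prefixes t"
      using r l unfolding res st'(2) by simp
    have "t \<noteq> []" using l by auto
    then obtain b' where b': "t' = t @ [b']" "(last t, b') \<in> acc B"
      using prefixes_extend[OF st'(1) len _ comp] by blast
    with z' st'(2) l have "(a', b') \<in> trace W (Suc j)"
      using traceI[of "s @ [a']" t' W A "Suc j"] by simp
    with b' ab show ?thesis by blast
  qed
  have backward: "\<exists>a'. (a, a') \<in> acc A \<and> (a', b') \<in> trace W (Suc j)"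
    if ab: "(a, b) \<in> trace W j" and j: "Suc j < n" and b': "(b, b') \<in> acc B" for a b j b'
  proof -
    obtain s t where t: "t \<in> worlds (unravel n B)"
      and xy: "(prefixes s, prefixes t) \<in> W (path_of B t)"
      and l: "length s = Suc j" "length t = Suc j" and ab: "a = last s" "b = last t"
      using traceE[OF W ab] by metis
    obtain z' where z': "z' \<in> W (path_of B (t @ [b']))" "snd z' = prefixes (t @ [b'])"
      and r: "res ?X (path_of B t) (path_of B (t @ [b'])) (restrict id {..<length t}) z' =
        (prefixes s, prefixes t)"
      using trivial_fibration_step[OF B X tfB t b'[unfolded ab(2)], of "(prefixes s, prefixes t)"] j l xy
      unfolding sec by auto
    obtain s' t' where st': "s' \<in> worlds (unravel n A)" "z' = (prefixes s', prefixes t')"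
      "path_of B (t @ [b']) = path_of A s'"
      using spans_prefixesE[OF W z'(1)] by blast
    have len: "length s' = Suc (length s)"
      using path_of_eq_length[OF st'(3)] l by simp
    have comp: "compose {..<length s} (prefixes s') (restrict id {..<length s}) = prefixes s"
      using r l unfolding res st'(2) by simp
    have "s \<noteq> []" using l by auto
    then obtain a' where a': "s' = s @ [a']" "(last s, a') \<in> acc A"
      using prefixes_extend[OF st'(1) len _ comp] by blast
    with z' st'(2,3) l have "(a', b') \<in> trace W (Suc j)"
      using traceI[of s' "t @ [b']" W A "Suc j"] by simp
    with a' ab show ?thesis by blast
  qed
  show ?thesis
    unfolding stepwise_bisim_def using root atoms forth backward by blast
qed

section \<open>Modal equivalence\<close>

primrec modal_depth :: "'p fm \<Rightarrow> nat" where
  "modal_depth (Atom p) = 0"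
| "modal_depth Falsum = 0"
| "modal_depth (Neg \<phi>) = modal_depth \<phi>"
| "modal_depth (Conj \<phi> \<psi>) = max (modal_depth \<phi>) (modal_depth \<psi>)"
| "modal_depth (Dia \<phi>) = Suc (modal_depth \<phi>)"

text \<open>Each \<open>Dia\<close> uses up one round, and the bound on the depth guarantees that
  enough rounds remain.\<close>

lemma stepwise_bisim_sat:
  assumes Z: "stepwise_bisim n A B Z" and "(a, b) \<in> Z j" "j + modal_depth \<phi> < n"
  shows "sat A a \<phi> \<longleftrightarrow> sat B b \<phi>"
  using assms(2,3)
proof (induction \<phi> arbitrary: a b j)
  case (Atom p)
  then show ?case using stepwise_bisimD(2)[OF Z] by simp
next
  case (Dia \<phi>)
  then have j: "Suc j < n" by simp
  have IH: "sat A a' \<phi> \<longleftrightarrow> sat B b' \<phi>" if "(a', b') \<in> Z (Suc j)" for a' b'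
    using Dia(1)[OF that] Dia(3) by simp
  show ?case
    using stepwise_bisimD(3,4)[OF Z j Dia(2)] IH unfolding sat.simps by blast
qed auto

section \<open>Characteristic formulas\<close>

text \<open>The complete description, relative to a finite \<open>F\<close>, of a world whose true
  formulas from \<open>F\<close> are those in \<open>S\<close>. \<open>F\<close> is enumerated
  arbitrarily, since \<open>fm\<close> has only binary conjunction; \<open>Neg Falsum\<close> is the
  empty conjunction.\<close>

definition characteristic :: "'p fm set \<Rightarrow> 'p fm set \<Rightarrow> 'p fm" where
  "characteristic F S =
     foldr (\<lambda>\<phi>. Conj (if \<phi> \<in> S then \<phi> else Neg \<phi>)) (SOME xs. set xs = F) (Neg Falsum)"

lemma sat_characteristic:
  assumes "finite F"
  shows "sat A w (characteristic F S) \<longleftrightarrow> (\<forall>\<phi>\<in>F. sat A w \<phi> \<longleftrightarrow> \<phi> \<in> S)"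
proof -
  have "sat A w (foldr (\<lambda>\<phi>. Conj (if \<phi> \<in> S then \<phi> else Neg \<phi>)) xs (Neg Falsum)) \<longleftrightarrow>
      (\<forall>\<phi>\<in>set xs. sat A w \<phi> \<longleftrightarrow> \<phi> \<in> S)" for xs
    by (induction xs) auto
  moreover have "set (SOME xs. set xs = F) = F"
    using finite_list[OF assms] by (rule someI_ex)
  ultimately show ?thesis by (simp add: characteristic_def)
qed

text \<open>
  Finitely many formulas suffice to win \<open>k\<close> rounds of the bisimulation game, because there are
  finitely many propositional variables.
\<close>

primrec tests :: "nat \<Rightarrow> 'p fm set" where
  "tests 0 = range Atom"
| "tests (Suc k) = range Atom \<union> (\<lambda>S. Dia (characteristic (tests k) S)) ` Pow (tests k)"

lemma finite_tests: "finite (tests k :: 'p :: finite fm set)"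
  by (induction k) simp_all

text \<open>The description of \<open>a'\<close> relative to \<open>tests k\<close>, under a
  diamond, is a test true at \<open>a\<close>, hence at \<open>b\<close>; any successor of
  \<open>b\<close> witnessing it is a reply.\<close>

lemma tests_forth:
  fixes A :: "('p :: finite, 'v) kripke" and B :: "('p, 'w) kripke"
  assumes "\<forall>\<phi>\<in>tests (Suc k). sat A a \<phi> \<longleftrightarrow> sat B b \<phi>" and a': "(a, a') \<in> acc A"
  obtains b' where "(b, b') \<in> acc B" "\<forall>\<phi>\<in>tests k. sat A a' \<phi> \<longleftrightarrow> sat B b' \<phi>"
proof -
  define S where "S = {\<phi> \<in> tests k. sat A a' \<phi>}"
  have "Dia (characteristic (tests k) S) \<in> tests (Suc k)" by (auto simp: S_def)
  moreover have "sat A a (Dia (characteristic (tests k) S))"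
    using a' by (auto simp: sat_characteristic[OF finite_tests] S_def)
  ultimately have "sat B b (Dia (characteristic (tests k) S))" using assms(1) by blast
  then show ?thesis
    using that by (auto simp: sat_characteristic[OF finite_tests] S_def)
qed

text \<open>Rounds are numbered from 0, so after round \<open>j\<close> there remain
  \<open>n - Suc j\<close> rounds; the pairs kept are those agreeing on the tests for that
  many.\<close>

lemma stepwise_bisim_tests:
  fixes A :: "('p :: finite, 'v) kripke" and B :: "('p, 'w) kripke"
  assumes "modally_equivalent A B"
  shows "stepwise_bisim n A B
    (\<lambda>j. {(a, b). \<forall>\<phi>\<in>tests (n - Suc j). sat A a \<phi> \<longleftrightarrow> sat B b \<phi>})"
proof -
  have atom: "Atom p \<in> tests k" for p :: 'p and k by (cases k) auto
  have "\<exists>k. n - Suc j = Suc k \<and> n - Suc (Suc j) = k" if "Suc j < n" for j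
    using that by arith
  moreover have "\<exists>a'. (a, a') \<in> acc A \<and> (\<forall>\<phi>\<in>tests k. sat A a' \<phi> \<longleftrightarrow> sat B b' \<phi>)"
    if "\<forall>\<phi>\<in>tests (Suc k). sat A a \<phi> \<longleftrightarrow> sat B b \<phi>" "(b, b') \<in> acc B" for a b b' k
    using tests_forth[of k B b A a b'] that by metis
  moreover have "\<exists>b'. (b, b') \<in> acc B \<and> (\<forall>\<phi>\<in>tests k. sat A a' \<phi> \<longleftrightarrow> sat B b' \<phi>)"
    if "\<forall>\<phi>\<in>tests (Suc k). sat A a \<phi> \<longleftrightarrow> sat B b \<phi>" "(a, a') \<in> acc A" for a b a' k
    using tests_forth[of k A a B b a'] that by metis
  ultimately show ?thesis
    using assms atom unfolding stepwise_bisim_def modally_equivalent_def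
    by (auto simp del: tests.simps) (metis sat.simps(1))+
qed

lemma modally_equivalent_iff:
  fixes A :: "('p :: finite, 'v) kripke" and B :: "('p, 'w) kripke"
  assumes A: "kripke_model A" and B: "kripke_model B"
  shows "modally_equivalent A B \<longleftrightarrow> strongly_nonempty (M_psh A B)"
proof
  assume "modally_equivalent A B"
  then show "strongly_nonempty (M_psh A B)"
    using span_of_spans[OF A B stepwise_bisim_tests]
    by (fastforce simp: strongly_nonempty_def M_psh_def)
next
  assume ne: "strongly_nonempty (M_psh A B)"
  have "sat A (pt A) \<phi> \<longleftrightarrow> sat B (pt B) \<phi>" for \<phi>
  proof -
    \<comment> \<open>One round for the roots and one for each nested diamond.\<close>
    let ?n = "Suc (modal_depth \<phi>)"
    obtain W where "W \<in> spans ?n (emb_psh (unravel ?n A)) (emb_psh (unravel ?n B))"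
      using ne by (fastforce simp: strongly_nonempty_def M_psh_def)
    then have Z: "stepwise_bisim ?n A B (trace W)" by (rule stepwise_bisim_trace[OF A B])
    show ?thesis
      by (rule stepwise_bisim_sat[OF Z stepwise_bisimD(1)[OF Z]]) simp_all
  qed
  then show "modally_equivalent A B" by (simp add: modally_equivalent_def)
qed

section \<open>Bisimilarity\<close>

text \<open>A family constant in the round is an ordinary bisimulation. The image of the apex of a
  span is one, and conversely a bisimulation is the apex of a span with the projections as
  legs.\<close>

lemma bisimilar_iff:
  fixes A :: "('p, 'v) kripke" and B :: "('p, 'w) kripke"
  assumes A: "kripke_model A" and B: "kripke_model B"
  shows "bisimilar A B \<longleftrightarrow> (\<exists>Z. \<forall>n. stepwise_bisim n A B (\<lambda>_. Z))"
proof
  assume "bisimilar A B"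
  then obtain C :: "('p, 'v \<times> 'w) kripke" and f g where C: "kripke_model C" and f: "p_morphism C A f" and g: "p_morphism C B g"
    unfolding bisimilar_def by blast
  have acc: "c' \<in> worlds C" if "(c, c') \<in> acc C" for c c'
    using C that by (auto simp: kripke_model_def)
  let ?Z = "(\<lambda>c. (f c, g c)) ` worlds C"
  have root: "(pt A, pt B) \<in> ?Z"
  proof -
    have "f (pt C) = pt A" "g (pt C) = pt B" "pt C \<in> worlds C"
      using C f g unfolding kripke_model_def p_morphism_def pathwise_embedding_def kripke_hom_def
      by blast+
    then show ?thesis by force
  qed
  have val: "f c \<in> val A p \<longleftrightarrow> g c \<in> val B p" if "c \<in> worlds C" for c p
    using f g that unfolding p_morphism_def pathwise_embedding_def kripke_hom_def by blast
  have forth: "\<exists>b'. (g c, b') \<in> acc B \<and> (a', b') \<in> ?Z"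
    if c: "c \<in> worlds C" "(f c, a') \<in> acc A" for c a'
  proof -
    obtain c' where "(c, c') \<in> acc C" "f c' = a'" using f c unfolding p_morphism_def by blast
    moreover from this have "(g c, g c') \<in> acc B"
      using g unfolding p_morphism_def pathwise_embedding_def kripke_hom_def by blast
    ultimately show ?thesis using acc by blast
  qed
  have backward: "\<exists>a'. (f c, a') \<in> acc A \<and> (a', b') \<in> ?Z"
    if c: "c \<in> worlds C" "(g c, b') \<in> acc B" for c b'
  proof -
    obtain c' where "(c, c') \<in> acc C" "g c' = b'" using g c unfolding p_morphism_def by blast
    moreover from this have "(f c, f c') \<in> acc A"
      using f unfolding p_morphism_def pathwise_embedding_def kripke_hom_def by blast
    ultimately show ?thesis using acc by blast
  qed
  have "stepwise_bisim n A B (\<lambda>_. ?Z)" for n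
    unfolding stepwise_bisim_def
  proof (intro conjI allI impI)
    fix a b assume "(a, b) \<in> ?Z"
    then obtain c where c: "c \<in> worlds C" "a = f c" "b = g c" by blast
    show "a \<in> val A p \<longleftrightarrow> b \<in> val B p" for p using val[OF c(1)] c by simp
    show "\<exists>b'. (b, b') \<in> acc B \<and> (a', b') \<in> ?Z" if "(a, a') \<in> acc A" for a'
      using forth[OF c(1)] that unfolding c by blast
    show "\<exists>a'. (a, a') \<in> acc A \<and> (a', b') \<in> ?Z" if "(b, b') \<in> acc B" for b'
      using backward[OF c(1)] that unfolding c by blast
  qed (rule root)
  then show "\<exists>Z. \<forall>n. stepwise_bisim n A B (\<lambda>_. Z)" by blast
next
  assume "\<exists>Z. \<forall>n. stepwise_bisim n A B (\<lambda>_. Z)"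
  then obtain Z where Z: "\<And>n. stepwise_bisim n A B (\<lambda>_. Z)" by blast
  \<comment> \<open>As \<open>Z\<close> does not depend on the round, one round gives the conditions
    on roots and variables, and two rounds give those on moves.\<close>
  note root = stepwise_bisimD(1)[OF Z[of 1], simplified]
    and val = stepwise_bisimD(2)[OF Z[of 1], of 0, simplified]
    and forth = stepwise_bisimD(3)[OF Z[of 2], of 0, simplified]
    and backward = stepwise_bisimD(4)[OF Z[of 2], of 0, simplified]
  \<comment> \<open>\<open>Z\<close> may contain pairs outside the models, hence the intersection.
    The valuation is taken from \<open>A\<close>; agreement on variables makes the second projection
    preserve and reflect it too.\<close>
  define C where "C = \<lparr>worlds = Z \<inter> worlds A \<times> worlds B,
    acc = {((a, b), (a', b')) | a b a' b'. (a, b) \<in> Z \<and> (a', b') \<in> Z \<and> (a, a') \<in> acc A \<and> (b, b') \<in> acc B},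
    val = (\<lambda>p. {(a, b) \<in> Z \<inter> worlds A \<times> worlds B. a \<in> val A p}), pt = (pt A, pt B)\<rparr>"
  have "kripke_model C"
    using A B root by (auto simp: C_def kripke_model_def)
  moreover have "p_morphism C A fst"
    unfolding p_morphism_def pathwise_embedding_def kripke_hom_def C_def
    using forth A by (fastforce simp: kripke_model_def)
  moreover have "p_morphism C B snd"
    unfolding p_morphism_def pathwise_embedding_def kripke_hom_def C_def
    using backward val B by (fastforce simp: kripke_model_def)
  ultimately show "bisimilar A B" by (rule bisimilarI)
qed

section \<open>Global sections\<close>

text \<open>Only runs of length at most \<open>m\<close> have the shape of a path in
  \<open>paths m\<close>, so at such paths the span does not depend on the height of the
  unravellings.\<close>

lemma span_of_bound:
  assumes "P \<in> paths m" "(x, y) \<in> span_of n A B Z P"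
  shows "(x, y) \<in> span_of m A B Z P"
  using assms(2)
proof (rule span_ofE)
  fix s t
  assume xy: "x = prefixes s" "y = prefixes t" and P: "P = path_of A s"
    and st: "s \<in> worlds (unravel n A)" "t \<in> worlds (unravel n B)" "length t = length s"
    and eq: "path_of A s = path_of B t" and Z: "\<And>j. j < length s \<Longrightarrow> (s ! j, t ! j) \<in> Z j"
  have "length s \<le> m" using paths_height[OF assms(1)] by (simp add: P worlds_path_of)
  with st have "s \<in> worlds (unravel m A)" "t \<in> worlds (unravel m B)"
    by (simp_all add: worlds_unravel)
  then show ?thesis unfolding xy P by (rule span_ofI[OF _ _ eq Z])
qed

text \<open>Makes the spans of a single \<open>Z\<close> at all levels a coherent family.\<close>

lemma restrict_span_of:
  assumes "m \<le> n"
  shows "restrict_paths m (span_of n A B Z) = span_of m A B Z"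
proof
  fix P :: "('a, nat) kripke"
  show "restrict_paths m (span_of n A B Z) P = span_of m A B Z P"
  proof (cases "P \<in> paths m")
    case True
    then have "P \<in> paths n" using paths_mono[OF assms] by blast
    with True show ?thesis using span_of_bound by (auto simp: restrict_paths_def)
  next
    case False
    then show ?thesis
      using subobject_span_of[of m A B Z] by (simp add: restrict_paths_def subobject_def)
  qed
qed

text \<open>Coherence makes the traces grow with the level, so every pair in their union can be
  viewed at a level where a further round remains.\<close>

lemma has_global_section_iff:
  assumes A: "kripke_model A" and B: "kripke_model B"
  shows "has_global_section (M_psh A B) \<longleftrightarrow> (\<exists>Z. \<forall>n. stepwise_bisim n A B (\<lambda>_. Z))"
proof
  assume "has_global_section (M_psh A B)"
  then obtain t where t: "omega_hom omega_terminal (M_psh A B) t"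
    unfolding has_global_section_def by blast
  define W where "W n = t n ()" for n
  have W: "W n \<in> spans n (emb_psh (unravel n A)) (emb_psh (unravel n B))" if "1 \<le> n" for n
    using t that by (auto simp: W_def omega_hom_def omega_terminal_def M_psh_def)
  have "W m = restrict_paths m (W n)" if "1 \<le> m" "m \<le> n" for m n
    using t that by (simp add: W_def omega_hom_def omega_terminal_def M_psh_def)
  then have mono: "trace (W m) j \<subseteq> trace (W n) j" if "1 \<le> m" "m \<le> n" for m n j
    using that by (fastforce simp: trace_def restrict_paths_def split: if_splits)
  \<comment> \<open>The union is also over rounds, since a bisimulation forgets when a pair is
    visited.\<close>
  let ?Z = "\<Union>n\<in>{1..}. \<Union>j. trace (W n) j"
  have step: "stepwise_bisim n A B (trace (W n))" if "1 \<le> n" for n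
    by (rule stepwise_bisim_trace[OF A B W[OF that]])
  \<comment> \<open>At level \<open>m\<close> the pair may be visited in the final round; at level
    \<open>Suc m\<close> it has a move left.\<close>
  have later: "\<exists>m j. 1 \<le> m \<and> Suc j < m \<and> (a, b) \<in> trace (W m) j" if "(a, b) \<in> ?Z" for a b
  proof -
    from that obtain m j where m: "1 \<le> m" "(a, b) \<in> trace (W m) j" by auto
    then obtain s where "s \<in> worlds (unravel m A)" "length s = Suc j"
      using traceE[OF W] by metis
    then have "Suc j < Suc m" by (simp add: worlds_unravel)
    moreover have "(a, b) \<in> trace (W (Suc m)) j" using m mono[of m "Suc m" j] by auto
    ultimately have "1 \<le> Suc m \<and> Suc j < Suc m \<and> (a, b) \<in> trace (W (Suc m)) j" by simp
    then show ?thesis by blast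
  qed
  have "stepwise_bisim n A B (\<lambda>_. ?Z)" for n
    unfolding stepwise_bisim_def
  proof (intro conjI allI impI)
    show "(pt A, pt B) \<in> ?Z" using stepwise_bisimD(1)[OF step[of 1]] by auto
    fix a b assume "(a, b) \<in> ?Z"
    then obtain m j where m: "1 \<le> m" "Suc j < m" "(a, b) \<in> trace (W m) j" using later by blast
    have Z: "trace (W m) (Suc j) \<subseteq> ?Z" using m(1) by auto
    note sb = step[OF m(1)]
    show "a \<in> val A p \<longleftrightarrow> b \<in> val B p" for p
      using stepwise_bisimD(2)[OF sb _ m(3)] m(2) by simp
    show "\<exists>b'. (b, b') \<in> acc B \<and> (a', b') \<in> ?Z" if "(a, a') \<in> acc A" for a'
      using stepwise_bisimD(3)[OF sb m(2,3) that] Z by blast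
    show "\<exists>a'. (a, a') \<in> acc A \<and> (a', b') \<in> ?Z" if "(b, b') \<in> acc B" for b'
      using stepwise_bisimD(4)[OF sb m(2,3) that] Z by blast
  qed
  then show "\<exists>Z. \<forall>n. stepwise_bisim n A B (\<lambda>_. Z)" by blast
next
  assume "\<exists>Z. \<forall>n. stepwise_bisim n A B (\<lambda>_. Z)"
  then obtain Z where "\<And>n. stepwise_bisim n A B (\<lambda>_. Z)" by blast
  then have "omega_hom omega_terminal (M_psh A B) (\<lambda>n _. span_of n A B (\<lambda>_. Z))"
    using span_of_spans[OF A B]
    by (simp add: omega_hom_def omega_terminal_def M_psh_def restrict_span_of)
  then show "has_global_section (M_psh A B)" unfolding has_global_section_def by blast
qed

theorem theorem6p6:
  fixes H :: "('p :: finite, 'w) kripke set"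
  assumes "\<forall>A\<in>H. kripke_model A"
  shows "hennessy_milner H \<longleftrightarrow>
    (\<forall>A\<in>H. \<forall>B\<in>H. strongly_nonempty (M_psh A B) \<longrightarrow> has_global_section (M_psh A B))"
  unfolding hennessy_milner_def
  using assms by (simp add: modally_equivalent_iff bisimilar_iff has_global_section_iff)

end
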